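(* Let $N>K$ be natural numbers and regard $\Lambda^N_K$ as a map $\mathbb G_N\to\mathscr P(\mathbb G_K)$, $X\mapsto\Lambda^N_K(X,\cdot)$. There exists a unique extension of this map to a map $\widetilde{\mathbb G}_N\to\mathscr P(\widetilde{\mathbb G}_K)$ which is continuous with respect to the weak topology on $\mathscr P(\widetilde{\mathbb G}_K)$.
   Context: Fix $q\in(0,1)$, $\zeta_+>0$, $\zeta_-<0$. Let $\mathfrak L=\{\zeta_+q^n:n\in\mathbb Z\}\cup\{\zeta_-q^n:n\in\mathbb Z\}\subset\mathbb R$ and $\bar{\mathfrak L}=\mathfrak L\cup\{0\}$. For $a<a'$ in $\mathfrak L$ set $I(a,a')=[a,a')\cap\mathfrak L$ if $a<a'<0$; $I(a,a')=[a,a']\cap\mathfrak L$ if $a<0<a'$; $I(a,a')=(a,a']\cap\mathfrak L$ if $0<a<a'$. For $M\ge1$, $\mathbb G_M$ is the set of $M$-point subsets $A=(a_1<\dots<a_M)$ of $\mathfrak L$. Write $|A|=|a_1|\cdots|a_M|$, $V(a_1,\dots,a_M)=\prod_{1\le i<j\le M}(a_i-a_j)$, and $|V(A)|$ for its absolute value. For $X=(x_1<\dots<x_{N+1})\in\mathbb G_{N+1}$ and $Y=(y_1<\dots<y_N)\in\mathbb G_N$ write $Y\prec X$ if $y_i\in I(x_i,x_{i+1})$ for $i=1,\dots,N$. Set $$\Lambda^{N+1}_N(X,Y)=(q;q)_N\,|Y|\,\frac{|V(Y)|}{|V(X)|}\ \text{ if } Y\prec X,\qquad \Lambda^{N+1}_N(X,Y)=0\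 \text{ otherwise},$$ where $(a;q)_N=\prod_{i=0}^{N-1}(1-aq^i)$. This is a stochastic matrix of format $\mathbb G_{N+1}\times\mathbb G_N$. For $N>K\ge1$ put $\Lambda^N_K=\Lambda^N_{N-1}\cdots\Lambda^{K+1}_K$, a stochastic matrix of format $\mathbb G_N\times\mathbb G_K$. Identify $\mathbb G_N$ with a subset of the cone $\Delta_N=\{(a_1,\dots,a_N)\in\mathbb R^N:a_1\le\dots\le a_N\}$; $\widetilde{\mathbb G}_N$ is the closure of $\mathbb G_N$ in $\Delta_N$ with the topology induced from $\Delta_N$. Its elements are the $N$-point configurations on $\bar{\mathfrak L}$ in which only $0$ may be a multiple point. $\mathscr P(\cdot)$ denotes the set of probability Borel measures; $\mathscr P(\mathbb G_K)$ is viewed as a subset of $\mathscr P(\widetilde{\mathbb G}_K)$. The weak topology on $\mathscr P(\widetilde{\mathbb G}_K)$ is the topology of convergence on bounded continuous functions on $\widetilde{\mathbb G}_K$. *)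

theory Defs
  imports "HOL-Probability.Probability"
begin

(* Points of R^M are functions nat => real on the index set {1..M}, extensional (undefined) outside
   it. The product topology on nat => real induces the Euclidean topology on
   {1..M} \<rightarrow>\<^sub>E UNIV, and its Borel sets induce the Borel sets of R^M. *)

definition two_sided_lattice :: "real \<Rightarrow> real \<Rightarrow> real \<Rightarrow> real set" where
  "two_sided_lattice q zp zm = range (\<lambda>n::int. zp * q powi n) \<union> range (\<lambda>n::int. zm * q powi n)"

(* Only used for a < a' in L, where L does not contain 0. *)
definition I :: "real set \<Rightarrow> real \<Rightarrow> real \<Rightarrow> real set" where
  "I L a a' = (if a' < 0 then {a..<a'} \<inter> L
               else if a < 0 then {a..a'} \<inter> L
               else {a<..a'} \<inter> L)"

definition \<Delta> :: "nat \<Rightarrow> (nat \<Rightarrow> real) set" where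
  "\<Delta> M = {a \<in> {1..M} \<rightarrow>\<^sub>E UNIV. mono_on {1..M} a}"

(* An M-point subset of L is identified with its increasing enumeration a_1 < ... < a_M. *)
definition \<G> :: "real set \<Rightarrow> nat \<Rightarrow> (nat \<Rightarrow> real) set" where
  "\<G> L M = {a \<in> {1..M} \<rightarrow>\<^sub>E L. strict_mono_on {1..M} a}"

definition \<G>_closure :: "real set \<Rightarrow> nat \<Rightarrow> (nat \<Rightarrow> real) set" where
  "\<G>_closure L M = top_of_set (\<Delta> M) closure_of \<G> L M"

definition q_pochhammer :: "real \<Rightarrow> real \<Rightarrow> nat \<Rightarrow> real" where
  "q_pochhammer a q N = (\<Prod>i<N. 1 - a * q ^ i)"

definition vandermonde :: "nat \<Rightarrow> (nat \<Rightarrow> real) \<Rightarrow> real" where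
  "vandermonde M a = (\<Prod>(i, j) \<in> {(i, j). 1 \<le> i \<and> i < j \<and> j \<le> M}. a i - a j)"

definition interlaces :: "real set \<Rightarrow> nat \<Rightarrow> (nat \<Rightarrow> real) \<Rightarrow> (nat \<Rightarrow> real) \<Rightarrow> bool" where
  "interlaces L N Y X \<longleftrightarrow> (\<forall>i\<in>{1..N}. Y i \<in> I L (X i) (X (i + 1)))"

(* The one-step matrix from level N + 1 to level N. *)
definition link :: "real \<Rightarrow> real set \<Rightarrow> nat \<Rightarrow> (nat \<Rightarrow> real) \<Rightarrow> (nat \<Rightarrow> real) \<Rightarrow> real" where
  "link q L N X Y =
     (if interlaces L N Y X
      then q_pochhammer q q N * (\<Prod>i\<in>{1..N}. \<bar>Y i\<bar>) *
             (\<bar>vandermonde N Y\<bar> / \<bar>vandermonde (N + 1) X\<bar>)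
      else 0)"

(* links q L K N is the matrix product from level N down to level K; only N > K is meaningful. *)
primrec links ::
  "real \<Rightarrow> real set \<Rightarrow> nat \<Rightarrow> nat \<Rightarrow> (nat \<Rightarrow> real) \<Rightarrow> (nat \<Rightarrow> real) \<Rightarrow> real" where
  "links q L K 0 = (\<lambda>X Y. 0)"
| "links q L K (Suc N) =
     (if N = K then link q L K
      else (\<lambda>X Y. \<Sum>\<^sub>\<infinity>Z\<in>\<G> L N. link q L N X Z * links q L K N Z Y))"

definition prob_measures :: "'a::topological_space set \<Rightarrow> 'a measure set" where
  "prob_measures S = {\<mu>. prob_space \<mu> \<and> sets \<mu> = sets (restrict_space borel S)}"

(* The coarsest topology making integration against every bounded continuous function on S
   continuous. *)
definition weak_topology :: "'a::topological_space set \<Rightarrow> 'a measure topology" where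
  "weak_topology S = topology_generated_by
     {{\<mu> \<in> prob_measures S. (\<integral>x. f x \<partial>\<mu>) \<in> U} |
        (f :: 'a \<Rightarrow> real) U. continuous_on S f \<and> bounded (f ` S) \<and> open U}"

(* The row of the matrix at X, pushed forward along the inclusion of \<G> L K in its closure. *)
definition links_measure ::
  "real \<Rightarrow> real set \<Rightarrow> nat \<Rightarrow> nat \<Rightarrow> (nat \<Rightarrow> real) \<Rightarrow> (nat \<Rightarrow> real) measure" where
  "links_measure q L K N X =
     distr (point_measure (\<G> L K) (\<lambda>Y. ennreal (links q L K N X Y)))
           (restrict_space borel (\<G>_closure L K)) (\<lambda>Y. Y)"

end

theory Submission
  imports Defs "Jordan_Normal_Form.Determinant"
begin

text \<open>
  On a box \<open>[b, a]\<close> the row of the link at \<open>X\<close> is a reweighting of the product of one-dimensional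
  probability measures with weights proportional to \<open>\<bar>y\<bar>\<close>, with density a constant times the
  Vandermonde product of \<open>Y\<close> restricted to \<open>Y \<prec> X\<close>; that it has mass 1 follows from
  \<open>det (x\<^sub>i\<^sub>+\<^sub>1 ^ (j+1) - x\<^sub>i ^ (j+1)) = \<Prod> (x\<^sub>j - x\<^sub>i)\<close>.

  If \<open>X\<^sub>n \<rightarrow> X\<close>, the nonzero coordinates of \<open>X\<^sub>n\<close> are eventually those of \<open>X\<close>. The coordinates of \<open>Y\<close>
  squeezed between two coordinates of \<open>X\<^sub>n\<close> that tend to 0 form a smaller copy of the link, of total
  mass 1, times a continuous factor, so integrating them out is evaluation at 0 in the limit. For the
  remaining coordinates dominated convergence applies, and the limit is an explicit probability measure.
  Hence expectations of bounded continuous functions extend continuously to the closure, and this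
  property is preserved by composition. Uniqueness holds by density, since bounded continuous
  functions separate the probability measures on the countable closure.
\<close>

section \<open>Vandermonde determinants\<close>

text \<open>The obstacle is \<open>1 / |V(X)|\<close>, which blows up when several coordinates of
  \<open>X\<close> merge at 0. Its singular part, the product over pairs of merging indices, is kept
  together with the indicators and the Vandermonde product of the squeezed coordinates of
  \<open>Y\<close>, so that no quotient of vanishing quantities has to be estimated. The mass of
  this block and the mass of a full row follow from one identity, which is therefore proved for any
  interval of consecutive indices. It rests on Jackson's q-integral: the sum of
  \<open>|y| y^m\<close> over \<open>I(c,d)\<close> is
  \<open>(d^(m+1) - c^(m+1)) / (1 - q^(m+1))\<close> whatever the signs of \<open>c\<close> and
  \<open>d\<close>, and the denominators for \<open>m < N\<close> multiply to
  \<open>(q;q)_N\<close>. The box turns all rows along a convergent sequence into densities against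
  one fixed probability measure, as dominated convergence requires; it is chosen around the limit
  and disappears from the final statements. The limiting expectation is expressed through
  \<open>X\<close> alone, so it cannot depend on the approximating sequence.\<close>

fun newton_coeff :: "(nat \<Rightarrow> 'a::comm_ring_1) \<Rightarrow> nat \<Rightarrow> nat \<Rightarrow> 'a" where
  "newton_coeff y 0 0 = 1"
| "newton_coeff y (Suc k) 0 = 0"
| "newton_coeff y 0 (Suc j) = y 0 * newton_coeff y 0 j"
| "newton_coeff y (Suc k) (Suc j) = newton_coeff y k j + y (Suc k) * newton_coeff y (Suc k) j"

lemma newton_coeff_eq_0: "j < k \<Longrightarrow> newton_coeff y k j = 0"
  by (induction y k j rule: newton_coeff.induct) auto

lemma newton_coeff_diag: "newton_coeff y k k = 1"
  by (induction k) (auto simp: newton_coeff_eq_0)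

text \<open>The coefficients are the complete homogeneous symmetric polynomials of degree
  \<open>j - k\<close> in \<open>y 0, ..., y k\<close>, that is, the divided differences of
  \<open>t ^ j\<close> at these nodes. Their recursion is \<open>t = (t - y k) + y k\<close> applied
  to each Newton polynomial.\<close>

lemma power_eq_newton_sum:
  fixes y :: "nat \<Rightarrow> 'a::comm_ring_1"
  shows "t ^ j = (\<Sum>k\<le>j. newton_coeff y k j * (\<Prod>l<k. t - y l))"
proof (induction j)
  case (Suc j)
  let ?N = "\<lambda>k. \<Prod>l<k. t - y l"
  have N: "t * ?N k = ?N (Suc k) + y k * ?N k" for k
    by (simp add: algebra_simps)
  have "t ^ Suc j = (\<Sum>k\<le>j. newton_coeff y k j * (t * ?N k))"
    by (simp add: Suc sum_distrib_left algebra_simps)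
  also have "\<dots> = (\<Sum>k\<le>j. newton_coeff y k j * ?N (Suc k)) + (\<Sum>k\<le>j. newton_coeff y k j * y k * ?N k)"
    unfolding N by (simp add: sum.distrib distrib_left mult.assoc del: prod.lessThan_Suc)
  also have "(\<Sum>k\<le>j. newton_coeff y k j * y k * ?N k) = (\<Sum>k\<le>Suc j. newton_coeff y k j * y k * ?N k)"
    by (simp add: newton_coeff_eq_0)
  also have "\<dots> = newton_coeff y 0 (Suc j) * ?N 0
      + (\<Sum>k\<le>j. newton_coeff y (Suc k) j * y (Suc k) * ?N (Suc k))"
    by (subst sum.atMost_Suc_shift) (simp add: mult.commute)
  finally show ?case
    unfolding sum.atMost_Suc_shift[of _ j]
    by (simp add: sum.distrib algebra_simps del: prod.lessThan_Suc)
qed simp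

text \<open>Passing from monomials to Newton polynomials factors the matrix: the \<open>k\<close>-th
  Newton polynomial vanishes at \<open>y i\<close> for \<open>i < k\<close>, so one factor is lower
  triangular with the wanted diagonal, and the change of basis is unitriangular.\<close>

lemma det_vandermonde:
  fixes y :: "nat \<Rightarrow> 'a::comm_ring_1"
  shows "Determinant.det (Matrix.mat n n (\<lambda>(i, j). y i ^ j)) = (\<Prod>i<n. \<Prod>l<i. y i - y l)"
proof -
  define A where "A = Matrix.mat n n (\<lambda>(i, k). \<Prod>l<k. y i - y l)"
  define U where "U = Matrix.mat n n (\<lambda>(k, j). newton_coeff y k j)"
  have A: "A \<in> carrier_mat n n" and U: "U \<in> carrier_mat n n"
    by (auto simp: A_def U_def)
  have "Matrix.mat n n (\<lambda>(i, j). y i ^ j) = A * U"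
  proof (rule eq_matI)
    fix i j assume "i < dim_row (A * U)" "j < dim_col (A * U)"
    then have ij: "i < n" "j < n" by (auto simp: A_def U_def)
    have "(A * U) $$ (i, j) = (\<Sum>k<n. newton_coeff y k j * (\<Prod>l<k. y i - y l))"
      using ij by (simp add: A_def U_def scalar_prod_def mult.commute lessThan_atLeast0)
    also have "\<dots> = (\<Sum>k\<le>j. newton_coeff y k j * (\<Prod>l<k. y i - y l))"
      using ij by (intro sum.mono_neutral_right) (auto simp: newton_coeff_eq_0)
    finally show "Matrix.mat n n (\<lambda>(i, j). y i ^ j) $$ (i, j) = (A * U) $$ (i, j)"
      using ij power_eq_newton_sum[of "y i" j y] by simp
  qed (auto simp: A_def U_def)
  moreover have "Determinant.det U = 1"
  proof -
    have "Determinant.det U = prod_list (diag_mat U)"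
      using U by (intro det_upper_triangular) (auto simp: U_def newton_coeff_eq_0)
    also have "diag_mat U = map (\<lambda>_. 1) [0..<n]"
      by (auto simp: diag_mat_def U_def newton_coeff_diag)
    finally show ?thesis by (simp add: map_replicate_const)
  qed
  moreover have "Determinant.det A = (\<Prod>i<n. \<Prod>l<i. y i - y l)"
  proof -
    have "Determinant.det A = prod_list (diag_mat A)"
      using A by (intro det_lower_triangular[where n=n]) (auto simp: A_def intro!: prod_zero)
    also have "diag_mat A = map (\<lambda>i. \<Prod>l<i. y i - y l) [0..<n]"
      by (auto simp: diag_mat_def A_def)
    finally show ?thesis
      by (simp add: prod.list_conv_set_nth prod.distinct_set_conv_list[symmetric] lessThan_atLeast0)
  qed
  ultimately show ?thesis
    using det_mult[OF A U] by simp
qed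

lemma det_vandermonde_differences:
  fixes x :: "nat \<Rightarrow> 'a::idom"
  shows "Determinant.det (Matrix.mat n n (\<lambda>(i, j). x (Suc i) ^ Suc j - x i ^ Suc j))
    = (\<Prod>i<Suc n. \<Prod>l<i. x i - x l)"
proof -
  define V where "V = Matrix.mat (Suc n) (Suc n) (\<lambda>(i, j). x i ^ j)"
  \<comment> \<open>Left multiplication by \<open>E\<close> subtracts from each row its predecessor.
    The constant first column becomes (1, 0, ..., 0), and the remaining block is
    \<open>M\<close>.\<close>
  define E where "E = Matrix.mat (Suc n) (Suc n)
    (\<lambda>(i, j). if i = j then 1 else if i = Suc j then - 1 else (0 :: 'a))"
  define M where "M = Matrix.mat n n (\<lambda>(i, j). x (Suc i) ^ Suc j - x i ^ Suc j)"
  have V: "V \<in> carrier_mat (Suc n) (Suc n)" and E: "E \<in> carrier_mat (Suc n) (Suc n)"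
    and M: "M \<in> carrier_mat n n"
    by (auto simp: V_def E_def M_def)
  have "E * V = four_block_mat (1\<^sub>m 1) (Matrix.mat 1 n (\<lambda>(i, j). x 0 ^ Suc j)) (0\<^sub>m n 1) M"
    (is "_ = ?F")
  proof (rule eq_matI)
    fix i j assume "i < dim_row ?F" "j < dim_col ?F"
    then have ij: "i < Suc n" "j < Suc n" by (auto simp: M_def)
    have "(E * V) $$ (i, j)
        = (\<Sum>k<Suc n. (if i = k then 1 else if i = Suc k then - 1 else 0) * x k ^ j)"
      using ij by (simp add: E_def V_def scalar_prod_def lessThan_atLeast0 del: sum.op_ivl_Suc)
    also have "\<dots> = (\<Sum>k<Suc n. (if k = i then x k ^ j else 0) + (if Suc k = i then - (x k ^ j) else 0))"
      by (intro sum.cong) auto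
    also have "\<dots> = x i ^ j + (\<Sum>k<Suc n. if Suc k = i then - (x k ^ j) else 0)"
      using ij by (simp only: sum.distrib) (simp del: sum.lessThan_Suc)
    also have "(\<Sum>k<Suc n. if Suc k = i then - (x k ^ j) else 0) = (if i = 0 then 0 else - (x (i - 1) ^ j))"
    proof (cases i)
      case (Suc i')
      then show ?thesis using ij by (simp del: sum.lessThan_Suc)
    qed (simp del: sum.lessThan_Suc)
    finally show "(E * V) $$ (i, j) = ?F $$ (i, j)"
      using ij by (cases i; cases j) (auto simp: M_def)
  qed (auto simp: E_def V_def M_def)
  moreover have "Determinant.det ?F = Determinant.det M"
    by (subst det_four_block_mat_lower_left_zero_col[where n=n]) (use M in auto)
  moreover have "Determinant.det E = 1"
  proof -
    have "Determinant.det E = prod_list (diag_mat E)"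
      by (intro det_lower_triangular[where n="Suc n"]) (use E in \<open>auto simp: E_def\<close>)
    also have "diag_mat E = map (\<lambda>_. 1) [0..<Suc n]"
      by (auto simp: diag_mat_def E_def simp del: upt_Suc)
    finally show ?thesis by (simp add: map_replicate_const del: upt_Suc)
  qed
  ultimately have "Determinant.det M = Determinant.det V"
    using det_mult[OF E V] by simp
  then show ?thesis
    unfolding M_def V_def by (simp only: det_vandermonde)
qed

section \<open>Summation over the lattice\<close>

text \<open>Expectations are Bochner integrals, whereas the matrix products in \<open>links\<close>
  are infinite sums; this is the bridge between them.\<close>

lemma expectation_eq_infsum:
  fixes g :: "'a \<Rightarrow> real"
  assumes "set_pmf p \<subseteq> A" "integrable (measure_pmf p) g"
  shows "measure_pmf.expectation p g = (\<Sum>\<^sub>\<infinity>x\<in>A. pmf p x * g x)"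
proof -
  have "integrable (count_space UNIV) (\<lambda>x. pmf p x * g x)"
    using assms(2) by (subst (asm) measure_pmf_eq_density, subst (asm) integrable_density) auto
  then have "Infinite_Set_Sum.abs_summable_on (\<lambda>x. pmf p x * g x) UNIV"
    by (simp add: Infinite_Set_Sum.abs_summable_on_def)
  then have "measure_pmf.expectation p g = (\<Sum>\<^sub>\<infinity>x. pmf p x * g x)"
    by (simp add: pmf_expectation_eq_infsetsum infsetsum_infsum)
  also have "\<dots> = (\<Sum>\<^sub>\<infinity>x\<in>A. pmf p x * g x)"
    by (rule infsum_cong_neutral) (use assms(1) in \<open>auto simp: set_pmf_iff\<close>)
  finally show ?thesis .
qed

lemma integrable_bounded_pmf:
  fixes g :: "'a \<Rightarrow> real"
  assumes "\<And>x. x \<in> set_pmf p \<Longrightarrow> \<bar>g x\<bar> \<le> C"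
  shows "integrable (measure_pmf p) g"
  by (rule measure_pmf.integrable_const_bound[where B=C]) (use assms in \<open>auto simp: AE_measure_pmf_iff\<close>)

locale q_lattice =
  fixes q zp zm :: real and L :: "real set"
  assumes q_pos: "0 < q" and q_less_1: "q < 1" and zp_pos: "0 < zp" and zm_neg: "zm < 0"
    and L_eq: "L = two_sided_lattice q zp zm"
begin

lemma L_cases:
  assumes "y \<in> L"
  obtains (pos) k :: int where "y = zp * q powi k" "y > 0" | (neg) k :: int where "y = zm * q powi k" "y < 0"
proof -
  have *: "q powi k > 0" for k using q_pos by simp
  show ?thesis
    using assms pos neg zp_pos zm_neg mult_pos_pos[OF zp_pos *] mult_neg_pos[OF zm_neg *]
    unfolding L_eq two_sided_lattice_def by blast
qed

lemma L_nonzero: "y \<in> L \<Longrightarrow> y \<noteq> 0"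
  by (metis L_cases less_irrefl)

lemma countable_L: "countable L"
  unfolding L_eq two_sided_lattice_def by auto

lemma powi_le_iff: "q powi k \<le> q powi l \<longleftrightarrow> l \<le> k"
proof
  assume "l \<le> k"
  then have "q powi k = q powi l * q ^ nat (k - l)"
    using q_pos by (simp add: power_int_add[symmetric] flip: power_int_of_nat)
  then show "q powi k \<le> q powi l"
    using q_pos q_less_1 by (simp add: mult_left_le power_le_one)
next
  assume le: "q powi k \<le> q powi l"
  show "l \<le> k"
  proof (rule ccontr)
    assume "\<not> l \<le> k"
    then have "q powi l = q powi k * q ^ nat (l - k)" "nat (l - k) > 0"
      using q_pos by (simp_all add: power_int_add[symmetric] flip: power_int_of_nat)
    then have "q powi l < q powi k"
      using q_pos q_less_1 by (simp add: power_less_one_iff)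
    then show False using le by simp
  qed
qed

definition tail :: "real \<Rightarrow> real set" where
  "tail a = range (\<lambda>n::nat. a * q ^ n)"

lemma range_powi_le: "{y \<in> range (\<lambda>n::int. z * q powi n). \<exists>l\<ge>k. y = z * q powi l} = tail (z * q powi k)"
proof -
  have "z * q powi l = z * q powi k * q ^ nat (l - k)" if "l \<ge> k" for l
    using q_pos that by (simp add: power_int_add[symmetric] flip: power_int_of_nat)
  moreover have "z * q powi k * q ^ n = z * q powi (k + int n)" for n
    using q_pos by (simp add: power_int_add)
  ultimately show ?thesis
    unfolding tail_def by (auto; metis rangeI le_add_same_cancel1 of_nat_0_le_iff)
qed

lemma tail_pos:
  assumes "a \<in> L" "0 < a"
  shows "tail a = {0<..a} \<inter> L"
proof -
  from assms obtain k where k: "a = zp * q powi k" by (metis L_cases less_asym)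
  have "{0<..a} \<inter> L = {y \<in> range (\<lambda>n::int. zp * q powi n). \<exists>l\<ge>k. y = zp * q powi l}"
  proof (intro Set.set_eqI iffI)
    fix y assume "y \<in> {0<..a} \<inter> L"
    then obtain l where "y = zp * q powi l" "y \<le> a"
      by (metis IntE L_cases greaterThanAtMost_iff less_asym)
    then show "y \<in> {y \<in> range (\<lambda>n::int. zp * q powi n). \<exists>l\<ge>k. y = zp * q powi l}"
      using zp_pos by (auto simp: k powi_le_iff)
  next
    fix y assume "y \<in> {y \<in> range (\<lambda>n::int. zp * q powi n). \<exists>l\<ge>k. y = zp * q powi l}"
    then show "y \<in> {0<..a} \<inter> L"
      using zp_pos q_pos by (auto simp: k powi_le_iff L_eq two_sided_lattice_def)
  qed
  then show ?thesis by (simp add: range_powi_le k)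
qed

lemma tail_neg:
  assumes "a \<in> L" "a < 0"
  shows "tail a = {a..<0} \<inter> L"
proof -
  from assms obtain k where k: "a = zm * q powi k" by (metis L_cases less_asym)
  have "{a..<0} \<inter> L = {y \<in> range (\<lambda>n::int. zm * q powi n). \<exists>l\<ge>k. y = zm * q powi l}"
  proof (intro Set.set_eqI iffI)
    fix y assume "y \<in> {a..<0} \<inter> L"
    then obtain l where "y = zm * q powi l" "a \<le> y"
      by (metis IntE L_cases atLeastLessThan_iff less_asym)
    then show "y \<in> {y \<in> range (\<lambda>n::int. zm * q powi n). \<exists>l\<ge>k. y = zm * q powi l}"
      using zm_neg by (auto simp: k powi_le_iff)
  next
    fix y assume "y \<in> {y \<in> range (\<lambda>n::int. zm * q powi n). \<exists>l\<ge>k. y = zm * q powi l}"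
    then show "y \<in> {a..<0} \<inter> L"
      using zm_neg q_pos by (auto simp: k powi_le_iff L_eq two_sided_lattice_def mult_neg_pos)
  qed
  then show ?thesis by (simp add: range_powi_le k)
qed

text \<open>A geometric series of ratio \<open>q ^ Suc m\<close>, since
  \<open>|a| * a ^ m = sgn a * a ^ Suc m\<close>.\<close>

lemma has_sum_tail:
  assumes "a \<in> L"
  shows "((\<lambda>y. \<bar>y\<bar> * y ^ m) has_sum (sgn a * (a ^ Suc m / (1 - q ^ Suc m)))) (tail a)"
proof -
  have inj: "inj (\<lambda>n::nat. a * q ^ n)"
    using L_nonzero[OF assms] q_pos q_less_1 by (auto simp: inj_def power_inject_exp')
  define r where "r = q ^ Suc m"
  have r: "0 < r" "r < 1"
    using q_pos q_less_1 by (simp_all add: r_def power_Suc_less_one del: power_Suc)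
  have "(\<lambda>n. sgn a * a ^ Suc m * r ^ n) sums (sgn a * a ^ Suc m * (1 / (1 - r)))"
    using r by (intro sums_mult geometric_sums) auto
  moreover have "summable (\<lambda>n. norm (sgn a * a ^ Suc m * r ^ n))"
    using r by (simp add: norm_mult norm_power abs_mult summable_mult summable_geometric del: power_Suc)
  ultimately have "((\<lambda>n. sgn a * a ^ Suc m * r ^ n) has_sum (sgn a * a ^ Suc m * (1 / (1 - r)))) UNIV"
    by (rule norm_summable_imp_has_sum[rotated])
  also have "(\<lambda>n. sgn a * a ^ Suc m * r ^ n) = (\<lambda>y. \<bar>y\<bar> * y ^ m) \<circ> (\<lambda>n. a * q ^ n)"
    using q_pos by (auto simp: fun_eq_iff r_def abs_mult power_mult_distrib sgn_if power_mult[symmetric] 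
      power_add mult.commute)
  finally show ?thesis
    unfolding tail_def using inj by (simp add: has_sum_reindex r_def o_def)
qed

text \<open>Up to the factor \<open>1 - q\<close> this is Jackson's q-integral of
  \<open>y ^ m\<close>. With the half-open conventions of \<open>I\<close> each interval is a
  difference or disjoint union of two tails, and the signs from \<open>has_sum_tail\<close> then
  give one formula in all three cases.\<close>

lemma has_sum_I:
  assumes "c \<in> L" "d \<in> L" "c < d"
  shows "((\<lambda>y. \<bar>y\<bar> * y ^ m) has_sum ((d ^ Suc m - c ^ Suc m) / (1 - q ^ Suc m))) (I L c d)"
proof -
  note tails = has_sum_tail[OF assms(1), of m] has_sum_tail[OF assms(2), of m]
  have nz: "c \<noteq> 0" "d \<noteq> 0" using assms L_nonzero by auto
  consider "0 < c" | "c < 0" "0 < d" | "d < 0" using nz by linarith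
  then show ?thesis
  proof cases
    case 1
    then have "I L c d = tail d - tail c" "tail c \<subseteq> tail d"
      using assms by (auto simp: I_def tail_pos)
    then show ?thesis
      using has_sum_Diff[OF tails(2) tails(1)] 1 assms by (simp add: diff_divide_distrib)
  next
    case 2
    then have "I L c d = tail c \<union> tail d" "tail c \<inter> tail d = {}"
      using assms by (auto simp: I_def tail_pos tail_neg dest: L_nonzero)
    then show ?thesis
      using has_sum_Un_disjoint[OF tails] 2 by (simp add: diff_divide_distrib)
  next
    case 3
    then have "I L c d = tail c - tail d" "tail d \<subseteq> tail c"
      using assms by (auto simp: I_def tail_neg)
    then show ?thesis
      using has_sum_Diff[OF tails(1) tails(2)] 3 assms by (simp add: diff_divide_distrib)
  qed
qed

lemma I_subset: "I L c d \<subseteq> {c..d} \<inter> L"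
  by (auto simp: I_def)

end

locale q_lattice_box = q_lattice +
  fixes b a :: real
  assumes b_in: "b \<in> L" and a_in: "a \<in> L" and b_neg: "b < 0" and a_pos: "0 < a"
begin

text \<open>The normalisation is \<open>has_sum_I\<close> at \<open>m = 0\<close>: the sum of
  \<open>|y|\<close> over the box is \<open>(a - b) / (1 - q)\<close>.\<close>

definition \<beta> :: "real pmf" where
  "\<beta> = embed_pmf (\<lambda>y. if y \<in> {b..a} \<inter> L then \<bar>y\<bar> * ((1 - q) / (a - b)) else 0)"

lemma I_box: "I L b a = {b..a} \<inter> L"
  using b_neg a_pos by (auto simp: I_def)

lemma pmf_\<beta>: "pmf \<beta> y = (if y \<in> {b..a} \<inter> L then \<bar>y\<bar> * ((1 - q) / (a - b)) else 0)"
  unfolding \<beta>_def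
proof (rule pmf_embed_pmf)
  let ?w = "\<lambda>y. \<bar>y\<bar> * ((1 - q) / (a - b))"
  have *: "((\<lambda>y. \<bar>y\<bar> * y ^ 0) has_sum ((a ^ Suc 0 - b ^ Suc 0) / (1 - q ^ Suc 0))) (I L b a)"
    using a_in b_in a_pos b_neg by (intro has_sum_I) auto
  have nonneg: "\<bar>?w y\<bar> = ?w y" for y
    using q_less_1 a_pos b_neg by (simp add: abs_mult)
  note has_sum_cmult_left[OF *, of "(1 - q) / (a - b)"]
  moreover have "(a ^ Suc 0 - b ^ Suc 0) / (1 - q ^ Suc 0) * ((1 - q) / (a - b)) = 1"
    using q_less_1 a_pos b_neg by simp
  ultimately have *: "(?w has_sum 1) (I L b a)"
    by (simp only: power_0 mult_1_right)
  then have "Infinite_Sum.abs_summable_on ?w (I L b a)"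
    using has_sum_imp_summable[OF *] by (simp only: nonneg real_norm_def)
  then have abs: "Infinite_Set_Sum.abs_summable_on ?w (I L b a)"
    by (simp only: abs_summable_equivalent)
  have "(\<integral>\<^sup>+ y. ennreal (if y \<in> {b..a} \<inter> L then ?w y else 0) \<partial>count_space UNIV)
     = (\<integral>\<^sup>+ y. ennreal (?w y) * indicator (I L b a) y \<partial>count_space UNIV)"
    by (intro nn_integral_cong) (auto simp: I_box)
  also have "\<dots> = (\<integral>\<^sup>+ y. ennreal (?w y) \<partial>count_space (I L b a))"
    by (simp add: nn_integral_count_space_indicator)
  also have "\<dots> = ennreal (infsetsum ?w (I L b a))"
    using q_less_1 a_pos b_neg by (intro nn_integral_conv_infsetsum abs) auto
  also have "\<dots> = 1"
    unfolding infsetsum_infsum[OF abs] infsumI[OF *] by simp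
  finally show "(\<integral>\<^sup>+ y. ennreal (if y \<in> {b..a} \<inter> L then ?w y else 0) \<partial>count_space UNIV) = 1" .
qed (use q_less_1 a_pos b_neg in auto)

lemma set_pmf_\<beta>: "set_pmf \<beta> = {b..a} \<inter> L"
  using q_less_1 a_pos b_neg by (auto simp: set_pmf_iff pmf_\<beta> dest: L_nonzero split: if_splits)

definition R :: real where "R = max a (- b)"

lemma abs_le_R: "y \<in> {b..a} \<Longrightarrow> \<bar>y\<bar> \<le> R"
  by (auto simp: R_def)

lemma R_pos: "0 < R"
  using a_pos by (simp add: R_def)

lemma expectation_\<beta>_power:
  assumes "c \<in> L" "d \<in> L" "c < d" "b \<le> c" "d \<le> a"
  shows "measure_pmf.expectation \<beta> (\<lambda>y. of_bool (y \<in> I L c d) * y ^ m)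
    = (1 - q) / (a - b) * ((d ^ Suc m - c ^ Suc m) / (1 - q ^ Suc m))"
proof -
  have "\<bar>of_bool (y \<in> I L c d) * y ^ m\<bar> \<le> R ^ m" if "y \<in> set_pmf \<beta>" for y
    using that abs_le_R R_pos by (auto simp: set_pmf_\<beta> power_abs power_mono)
  then have "measure_pmf.expectation \<beta> (\<lambda>y. of_bool (y \<in> I L c d) * y ^ m)
     = (\<Sum>\<^sub>\<infinity>y\<in>{b..a} \<inter> L. pmf \<beta> y * (of_bool (y \<in> I L c d) * y ^ m))"
    by (intro expectation_eq_infsum integrable_bounded_pmf) (auto simp only: set_pmf_\<beta>)
  also have "\<dots> = (\<Sum>\<^sub>\<infinity>y\<in>I L c d. (1 - q) / (a - b) * (\<bar>y\<bar> * y ^ m))"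
    by (rule infsum_cong_neutral) (use assms I_subset[of c d] in \<open>auto simp: pmf_\<beta>\<close>)
  also have "\<dots> = (1 - q) / (a - b) * ((d ^ Suc m - c ^ Suc m) / (1 - q ^ Suc m))"
    by (intro infsumI has_sum_cmult_right has_sum_I assms)
  finally show ?thesis .
qed

end

section \<open>Expectations and Vandermonde products\<close>

lemma expectation_bind_pmf:
  fixes f :: "'a \<Rightarrow> real"
  assumes "\<And>x. x \<in> set_pmf (bind_pmf p r) \<Longrightarrow> \<bar>f x\<bar> \<le> C"
  shows "measure_pmf.expectation (bind_pmf p r) f
    = measure_pmf.expectation p (\<lambda>x. measure_pmf.expectation (r x) f)"
proof -
  \<comment> \<open>The bound on \<open>f\<close> is known only on the support, but integrating
    against a mixture asks for a global bound; truncation changes nothing almost everywhere.\<close>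
  let ?f = "\<lambda>x. if x \<in> set_pmf (bind_pmf p r) then f x else 0"
  have r: "(\<lambda>x. measure_pmf (r x)) \<in> measurable (count_space UNIV) (subprob_algebra (count_space UNIV))"
    by (simp add: measure_pmf_in_subprob_algebra)
  have "measure_pmf.expectation (bind_pmf p r) f = measure_pmf.expectation (bind_pmf p r) ?f"
    by (intro integral_cong_AE) (auto simp: AE_measure_pmf_iff)
  also have "\<dots> = measure_pmf.expectation p (\<lambda>x. measure_pmf.expectation (r x) ?f)"
    unfolding measure_pmf_bind
    by (rule integral_bind[where B="\<bar>C\<bar>" and B'=1 and K="count_space UNIV"])
       (use r in \<open>auto simp: measure_pmf.finite_measure measure_pmf.emeasure_space_1
          intro!: order_trans[OF assms] abs_ge_self\<close>)
  also have "\<dots> = measure_pmf.expectation p (\<lambda>x. measure_pmf.expectation (r x) f)"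
    by (intro integral_cong_AE) (auto simp: AE_measure_pmf_iff intro!: integral_cong_AE)
  finally show ?thesis .
qed

lemma expectation_pair_pmf:
  fixes f :: "'a \<Rightarrow> 'b \<Rightarrow> real"
  assumes "\<And>x y. x \<in> set_pmf p \<Longrightarrow> y \<in> set_pmf r \<Longrightarrow> \<bar>f x y\<bar> \<le> C"
  shows "measure_pmf.expectation (pair_pmf p r) (\<lambda>z. f (fst z) (snd z))
    = measure_pmf.expectation p (\<lambda>x. measure_pmf.expectation r (f x))"
proof -
  have "measure_pmf.expectation (pair_pmf p r) (\<lambda>z. f (fst z) (snd z))
    = measure_pmf.expectation p (\<lambda>x. measure_pmf.expectation
        (bind_pmf r (\<lambda>y. return_pmf (x, y))) (\<lambda>z. f (fst z) (snd z)))"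
    unfolding pair_pmf_def by (rule expectation_bind_pmf) (use assms in auto)
  also have "\<dots> = measure_pmf.expectation p (\<lambda>x. measure_pmf.expectation r (f x))"
    by (simp add: map_pmf_def[symmetric])
  finally show ?thesis .
qed

lemma expectation_prod_Pi_pmf_bounded:
  fixes f :: "'a \<Rightarrow> 'b \<Rightarrow> real"
  assumes "finite A" and bnd: "\<And>x y. x \<in> A \<Longrightarrow> y \<in> set_pmf (p x) \<Longrightarrow> \<bar>f x y\<bar> \<le> C"
  shows "measure_pmf.expectation (Pi_pmf A d p) (\<lambda>y. \<Prod>x\<in>A. f x (y x))
    = (\<Prod>x\<in>A. measure_pmf.expectation (p x) (f x))"
  using assms
proof (induction A rule: finite_induct)
  case (insert a A)
  let ?g = "\<lambda>v u. f a v * (\<Prod>x\<in>A. f x (u x))"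
  have bound: "\<bar>?g v u\<bar> \<le> C * C ^ card A" if "v \<in> set_pmf (p a)" "u \<in> set_pmf (Pi_pmf A d p)" for v u
  proof -
    have "0 \<le> C" using insert.prems[of a v] that by force
    moreover have "(\<Prod>x\<in>A. \<bar>f x (u x)\<bar>) \<le> (\<Prod>x\<in>A. C)"
      using that insert by (intro prod_mono) (auto simp: set_Pi_pmf PiE_dflt_def)
    ultimately show ?thesis
      using insert.prems[of a v] that
      by (auto simp: abs_mult abs_prod intro!: mult_mono prod_nonneg)
  qed
  have "measure_pmf.expectation (Pi_pmf (insert a A) d p) (\<lambda>y. \<Prod>x\<in>insert a A. f x (y x))
    = measure_pmf.expectation (pair_pmf (p a) (Pi_pmf A d p)) (\<lambda>z. ?g (fst z) (snd z))"
    using insert.hyps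
    by (subst Pi_pmf_insert)
       (auto simp: case_prod_unfold intro!: Bochner_Integration.integral_cong prod.cong)
  also have "\<dots> = measure_pmf.expectation (p a) (\<lambda>v. measure_pmf.expectation (Pi_pmf A d p) (?g v))"
    by (rule expectation_pair_pmf) (rule bound)
  also have "\<dots> = (\<Prod>x\<in>insert a A. measure_pmf.expectation (p x) (f x))"
    using insert by simp
  finally show ?case .
qed simp

section \<open>Absolute Vandermonde products over arbitrary index sets\<close>

definition vdm :: "nat set \<Rightarrow> (nat \<Rightarrow> real) \<Rightarrow> real" where
  "vdm A y = (\<Prod>(i, j)\<in>{(i, j). i \<in> A \<and> j \<in> A \<and> i < j}. \<bar>y i - y j\<bar>)"

lemma finite_index_pairs: "finite A \<Longrightarrow> finite {(i, j). i \<in> A \<and> j \<in> A \<and> i < (j :: nat)}"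
  by (rule finite_subset[of _ "A \<times> A"]) auto

lemma abs_vandermonde: "\<bar>vandermonde M y\<bar> = vdm {1..M} y"
proof -
  have "{(i, j). 1 \<le> i \<and> i < j \<and> j \<le> M} = {(i, j). i \<in> {1..M} \<and> j \<in> {1..M} \<and> i < j}"
    by auto
  then show ?thesis
    by (simp add: vandermonde_def vdm_def abs_prod case_prod_unfold)
qed

lemma vdm_nonneg: "0 \<le> vdm A y"
  unfolding vdm_def by (intro prod_nonneg) auto

lemma vdm_cong: "(\<And>i. i \<in> A \<Longrightarrow> y i = y' i) \<Longrightarrow> vdm A y = vdm A y'"
  unfolding vdm_def by (intro prod.cong) auto

lemma vdm_pos:
  assumes "finite A" "inj_on y A"
  shows "0 < vdm A y"
  unfolding vdm_def using assms by (intro prod_pos) (auto dest: inj_onD)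

lemma vdm_small: "finite A \<Longrightarrow> card A \<le> 1 \<Longrightarrow> vdm A y = 1"
  unfolding vdm_def by (rule prod.neutral) (auto simp: card_le_Suc0_iff_eq)

text \<open>The mixed pairs are enumerated by \<open>A \<times> B\<close> and sorted by
  \<open>(min, max)\<close>; absolute values make the orientation irrelevant. This is what later
  separates the coordinates merging at 0 from the others.\<close>

lemma vdm_union:
  assumes "finite A" "finite B" "A \<inter> B = {}"
  shows "vdm (A \<union> B) y = vdm A y * vdm B y * (\<Prod>a\<in>A. \<Prod>b\<in>B. \<bar>y a - y b\<bar>)"
proof -
  let ?P = "\<lambda>A. {(i, j). i \<in> A \<and> j \<in> A \<and> i < (j :: nat)}"
  let ?d = "\<lambda>(i, j). \<bar>y i - y j\<bar>"
  define Q where "Q = (\<lambda>(i, j). (min i j, max i j)) ` (A \<times> B)"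
  have inj: "inj_on (\<lambda>(i, j). (min i j, max i j)) (A \<times> B)"
    using assms(3) by (auto simp: inj_on_def min_def max_def split: if_splits)
  have "?P (A \<union> B) = ?P A \<union> ?P B \<union> Q"
  proof (intro equalityI subsetI)
    fix z assume z: "z \<in> ?P (A \<union> B)"
    obtain i j where ij: "z = (i, j)" by (cases z)
    show "z \<in> ?P A \<union> ?P B \<union> Q"
    proof (cases "i \<in> A \<longleftrightarrow> j \<in> A")
      case False
      then have "(i, j) \<in> A \<times> B \<or> (j, i) \<in> A \<times> B" "i < j" using z ij by auto
      then have "z \<in> Q" unfolding Q_def ij by (force simp: image_iff)
      then show ?thesis by simp
    qed (use z assms(3) ij in auto)
  next
    fix z assume "z \<in> ?P A \<union> ?P B \<union> Q"
    then consider "z \<in> ?P A \<union> ?P B" | i j where "i \<in> A" "j \<in> B" "z = (min i j, max i j)"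
      unfolding Q_def by auto
    then show "z \<in> ?P (A \<union> B)"
    proof cases
      case (2 i j)
      then have "i \<noteq> j" using assms(3) by auto
      with 2 show ?thesis by (cases "i < j") (auto simp: min_def max_def)
    qed auto
  qed
  moreover have "?P A \<inter> ?P B = {}" "(?P A \<union> ?P B) \<inter> Q = {}"
    using assms(3) by (auto simp: Q_def min_def max_def split: if_splits)
  moreover have "finite Q" using assms by (simp add: Q_def)
  ultimately have "prod ?d (?P (A \<union> B)) = prod ?d (?P A) * prod ?d (?P B) * prod ?d Q"
    using finite_index_pairs assms by (simp add: prod.union_disjoint)
  also have "prod ?d Q = (\<Prod>(a, b)\<in>A \<times> B. \<bar>y a - y b\<bar>)"
    unfolding Q_def by (subst prod.reindex[OF inj]) (auto intro!: prod.cong simp: min_def max_def)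
  also have "\<dots> = (\<Prod>a\<in>A. \<Prod>b\<in>B. \<bar>y a - y b\<bar>)"
    by (simp add: prod.cartesian_product)
  finally show ?thesis by (simp add: vdm_def)
qed

lemma vdm_le:
  assumes "finite A" "\<And>i. i \<in> A \<Longrightarrow> \<bar>y i\<bar> \<le> C" "1 \<le> C"
  shows "vdm A y \<le> (2 * C) ^ (card A)\<^sup>2"
proof -
  let ?P = "{(i, j). i \<in> A \<and> j \<in> A \<and> i < (j :: nat)}"
  have "vdm A y \<le> (\<Prod>(i, j)\<in>?P. 2 * C)"
    unfolding vdm_def
  proof (intro prod_mono)
    fix z assume "z \<in> ?P"
    then obtain i j where "z = (i, j)" "i \<in> A" "j \<in> A" by auto
    then show "0 \<le> (case z of (i, j) \<Rightarrow> \<bar>y i - y j\<bar>) \<and>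
        (case z of (i, j) \<Rightarrow> \<bar>y i - y j\<bar>) \<le> (case z of (i, j) \<Rightarrow> 2 * C)"
      using assms(2)[of i] assms(2)[of j] by simp
  qed
  also have "\<dots> = (2 * C) ^ card ?P" by simp
  also have "\<dots> \<le> (2 * C) ^ (card A)\<^sup>2"
  proof (rule power_increasing)
    have "card ?P \<le> card (A \<times> A)" by (rule card_mono) (use assms in auto)
    then show "card ?P \<le> (card A)\<^sup>2" by (simp add: card_cartesian_product power2_eq_square)
  qed (use assms in auto)
  finally show ?thesis .
qed

lemma vdm_interval:
  assumes "\<And>i. s \<le> i \<Longrightarrow> Suc i < s + n \<Longrightarrow> y i < y (Suc i)"
  shows "vdm {s..<s + n} y = (\<Prod>i<n. \<Prod>l<i. y (s + i) - y (s + l))"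
proof -
  have less: "y (s + l) < y (s + i)" if "l < i" "i < n" for l i
    using that(1,2)
  proof (induction i)
    case (Suc i)
    have "y (s + i) < y (s + Suc i)" using assms[of "s + i"] Suc.prems by simp
    with Suc show ?case by (cases "l = i") auto
  qed simp
  have "{(i, j). i \<in> {s..<s + n} \<and> j \<in> {s..<s + n} \<and> i < j}
      = (\<lambda>(i, l). (s + l, s + i)) ` (SIGMA i:{..<n}. {..<i})" (is "_ = ?h ` ?S")
  proof (intro equalityI subsetI)
    fix z assume "z \<in> {(i, j). i \<in> {s..<s + n} \<and> j \<in> {s..<s + n} \<and> i < j}"
    then have "z = ?h (snd z - s, fst z - s)" "(snd z - s, fst z - s) \<in> ?S"
      by auto
    then show "z \<in> ?h ` ?S" by (rule image_eqI)
  qed auto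
  then have "vdm {s..<s + n} y = (\<Prod>(i, l)\<in>?S. \<bar>y (s + l) - y (s + i)\<bar>)"
    unfolding vdm_def by (simp add: prod.reindex inj_on_def case_prod_unfold)
  also have "\<dots> = (\<Prod>(i, l)\<in>?S. y (s + i) - y (s + l))"
    by (intro prod.cong refl) (auto simp: abs_of_neg less)
  also have "\<dots> = (\<Prod>i<n. \<Prod>l<i. y (s + i) - y (s + l))"
    by (subst prod.Sigma) auto
  finally show ?thesis .
qed

text \<open>The shared endpoint \<open>d\<close> belongs only to the left interval if
  \<open>d > 0\<close> and only to the right one if \<open>d < 0\<close>.\<close>

lemma (in q_lattice) interlaced_less:
  assumes "y \<in> I L c d" "y' \<in> I L d e" "d \<in> L"
  shows "y < y'"
  using assms L_nonzero[of d] unfolding I_def by (auto split: if_splits)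

context q_lattice_box
begin

definition \<kappa> :: real where "\<kappa> = (1 - q) / (a - b)"

lemma \<kappa>_pos: "0 < \<kappa>"
  unfolding \<kappa>_def using q_less_1 a_pos b_neg by simp

text \<open>Interlacing makes \<open>y\<close> increasing, so its Vandermonde product is a
  determinant. Each term of the Leibniz expansion is a product over independent coordinates with
  power moments as factors, and the sum over permutations reassembles into
  \<open>det_vandermonde_differences\<close>. The start \<open>s\<close> is free because the
  identity serves both a full row and the block of indices where the limit vanishes.\<close>

lemma expectation_vdm:
  assumes x: "\<And>i. s \<le> i \<Longrightarrow> i \<le> s + n \<Longrightarrow> x i \<in> {b..a} \<inter> L"
    and inc: "\<And>i. s \<le> i \<Longrightarrow> i < s + n \<Longrightarrow> x i < x (Suc i)"
  shows "measure_pmf.expectation (Pi_pmf {s..<s + n} dflt (\<lambda>_. \<beta>))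
      (\<lambda>y. (\<Prod>i\<in>{s..<s + n}. of_bool (y i \<in> I L (x i) (x (Suc i)))) * vdm {s..<s + n} y)
    = \<kappa> ^ n * vdm {s..s + n} x / q_pochhammer q q n"
proof -
  let ?P = "Pi_pmf {s..<s + n} dflt (\<lambda>_. \<beta>)"
  let ?E = "measure_pmf.expectation ?P"
  define J where "J i = I L (x (s + i)) (x (s + Suc i))" for i
  define g where "g = (\<lambda>p i v. of_bool (v \<in> J i) * (v :: real) ^ p i)" for p :: "nat \<Rightarrow> nat"
  let ?S = "{p. p permutes {0..<n}}"
  have shift: "(\<Prod>i\<in>{s..<s + n}. h i) = (\<Prod>i<n. h (s + i))" for h :: "nat \<Rightarrow> real"
    by (rule prod.reindex_bij_witness[of _ "\<lambda>i. s + i" "\<lambda>i. i - s"]) auto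
  have expand: "(\<Prod>i\<in>{s..<s + n}. of_bool (y i \<in> I L (x i) (x (Suc i)))) * vdm {s..<s + n} y
      = (\<Sum>p\<in>?S. signof p * (\<Prod>i\<in>{s..<s + n}. g p (i - s) (y i)))" for y
  proof (cases "\<forall>i<n. y (s + i) \<in> J i")
    case True
    have "y i < y (Suc i)" if "s \<le> i" "Suc i < s + n" for i
      using True that x[of "Suc i"] interlaced_less[of "y i" "x i" "x (Suc i)" "y (Suc i)" "x (Suc (Suc i))"]
        spec[OF True, of "i - s"] spec[OF True, of "Suc i - s"] by (auto simp: J_def)
    then have "vdm {s..<s + n} y = Determinant.det (Matrix.mat n n (\<lambda>(i, j). y (s + i) ^ j))"
      by (simp add: vdm_interval det_vandermonde)
    also have "\<dots> = (\<Sum>p\<in>?S. signof p * (\<Prod>i<n. y (s + i) ^ p i))"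
      by (subst det_def'[of _ n])
         (auto simp: lessThan_atLeast0 permutes_in_image intro!: sum.cong prod.cong)
    also have "\<dots> = (\<Sum>p\<in>?S. signof p * (\<Prod>i\<in>{s..<s + n}. g p (i - s) (y i)))"
      using True by (simp add: g_def shift)
    finally show ?thesis
      using True by (simp add: shift J_def)
  next
    case False
    then obtain k where "k < n" "y (s + k) \<notin> J k" by blast
    then have "(\<Prod>i<n. of_bool (y (s + i) \<in> J i)) = (0 :: real)" "(\<Prod>i<n. g p i (y (s + i))) = 0" for p
      by (auto simp: g_def intro!: prod_zero)
    then show ?thesis unfolding shift by (simp add: J_def del: prod_zero_iff)
  qed
  \<comment> \<open>Every exponent \<open>p i\<close> is below \<open>n\<close>, so
    \<open>max 1 R ^ n\<close> bounds all factors at once.\<close>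
  define C where "C = max 1 R ^ n"
  have g_bound: "\<bar>g p i v\<bar> \<le> C" if "v \<in> set_pmf \<beta>" "p \<in> ?S" "i < n" for p i v
  proof -
    have "\<bar>v\<bar> ^ p i \<le> max 1 R ^ p i"
      using that abs_le_R[of v] by (intro power_mono) (auto simp: set_pmf_\<beta>)
    also have "p i < n"
      using that permutes_in_image[of p "{0..<n}" i] by auto
    then have "max 1 R ^ p i \<le> C"
      unfolding C_def by (intro power_increasing) auto
    finally show ?thesis
      by (auto simp: g_def power_abs C_def)
  qed
  have E_g: "measure_pmf.expectation \<beta> (g p i)
      = \<kappa> * ((x (s + Suc i) ^ Suc (p i) - x (s + i) ^ Suc (p i)) / (1 - q ^ Suc (p i)))"
    if "i < n" for p i
    unfolding g_def J_def \<kappa>_def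
    using x[of "s + i"] x[of "s + Suc i"] inc[of "s + i"] that by (intro expectation_\<beta>_power) auto
  \<comment> \<open>A permutation only reorders the denominators, so their product is common to all
    terms of the expansion.\<close>
  have q_perm: "(\<Prod>i<n. 1 - q ^ Suc (p i)) = q_pochhammer q q n" if "p \<in> ?S" for p
    unfolding q_pochhammer_def power_Suc
    using that prod.permute[of p "{..<n}" "\<lambda>i. 1 - q * q ^ i"] by (simp add: lessThan_atLeast0 comp_def)
  have E_prod: "?E (\<lambda>y. \<Prod>i\<in>{s..<s + n}. g p (i - s) (y i))
      = \<kappa> ^ n / q_pochhammer q q n * (\<Prod>i<n. x (s + Suc i) ^ Suc (p i) - x (s + i) ^ Suc (p i))"
    if p: "p \<in> ?S" for p
  proof -
    have "?E (\<lambda>y. \<Prod>i\<in>{s..<s + n}. g p (i - s) (y i)) = (\<Prod>i<n. measure_pmf.expectation \<beta> (g p i))"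
      using g_bound p by (subst expectation_prod_Pi_pmf_bounded[where C=C]) (auto simp: shift)
    also have "\<dots> = (\<Prod>i<n. \<kappa> * ((x (s + Suc i) ^ Suc (p i) - x (s + i) ^ Suc (p i)) / (1 - q ^ Suc (p i))))"
      by (intro prod.cong) (simp_all only: E_g lessThan_iff)
    finally show ?thesis
      by (simp add: prod.distrib prod_dividef q_perm[OF p, simplified] power_divide)
  qed
  have int: "integrable (measure_pmf ?P) (\<lambda>y. \<Prod>i\<in>{s..<s + n}. g p (i - s) (y i))" if p: "p \<in> ?S" for p
  proof (rule integrable_bounded_pmf)
    fix y assume "y \<in> set_pmf ?P"
    then have "(\<Prod>i\<in>{s..<s + n}. \<bar>g p (i - s) (y i)\<bar>) \<le> (\<Prod>i\<in>{s..<s + n}. C)"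
      using g_bound p by (intro prod_mono) (auto simp: set_Pi_pmf PiE_dflt_def)
    then show "\<bar>\<Prod>i\<in>{s..<s + n}. g p (i - s) (y i)\<bar> \<le> C ^ n" by (simp add: abs_prod)
  qed
  have "?E (\<lambda>y. \<Sum>p\<in>?S. signof p * (\<Prod>i\<in>{s..<s + n}. g p (i - s) (y i)))
      = (\<Sum>p\<in>?S. signof p * ?E (\<lambda>y. \<Prod>i\<in>{s..<s + n}. g p (i - s) (y i)))"
    using int by (subst Bochner_Integration.integral_sum) auto
  also have "\<dots> = \<kappa> ^ n / q_pochhammer q q n *
      (\<Sum>p\<in>?S. signof p * (\<Prod>i<n. x (s + Suc i) ^ Suc (p i) - x (s + i) ^ Suc (p i)))"
    unfolding sum_distrib_left by (intro sum.cong refl, subst E_prod) (auto simp: algebra_simps)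
  also have "(\<Sum>p\<in>?S. signof p * (\<Prod>i<n. x (s + Suc i) ^ Suc (p i) - x (s + i) ^ Suc (p i)))
      = Determinant.det (Matrix.mat n n (\<lambda>(i, j). x (s + Suc i) ^ Suc j - x (s + i) ^ Suc j))"
    by (subst det_def'[of _ n])
       (auto simp: lessThan_atLeast0 permutes_in_image intro!: sum.cong prod.cong)
  also have "\<dots> = vdm {s..<s + Suc n} x"
    using det_vandermonde_differences[of n "\<lambda>i. x (s + i)"] inc by (subst vdm_interval) auto
  also have "{s..<s + Suc n} = {s..s + n}" by auto
  finally show ?thesis by (simp add: expand)
qed

lemma q_pochhammer_pos: "0 < q_pochhammer q q n"
proof -
  have "q * q ^ i < 1" for i
    using q_pos q_less_1 power_Suc_less_one[of q i] by simp
  then show ?thesis unfolding q_pochhammer_def by (intro prod_pos) simp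
qed

end

section \<open>Links as probability mass functions\<close>

lemma reweighted_pmf_exists:
  fixes w :: "'a \<Rightarrow> real"
  assumes nonneg: "\<And>x. 0 \<le> w x" and int: "integrable (measure_pmf p) w"
    and one: "measure_pmf.expectation p w = 1"
  obtains p' where "\<And>x. pmf p' x = pmf p x * w x"
    and "\<And>f :: 'a \<Rightarrow> real. measure_pmf.expectation p' f = measure_pmf.expectation p (\<lambda>x. w x * f x)"
proof -
  let ?g = "\<lambda>x. pmf p x * w x"
  have "(\<integral>\<^sup>+ x. ennreal (?g x) \<partial>count_space UNIV) = (\<integral>\<^sup>+ x. ennreal (w x) \<partial>measure_pmf p)"
    by (simp add: nn_integral_measure_pmf ennreal_mult nonneg)
  also have "\<dots> = 1"
    by (subst nn_integral_eq_integral) (use int nonneg one in auto)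
  finally have pmf: "pmf (embed_pmf ?g) x = ?g x" for x
    by (intro pmf_embed_pmf) (simp_all add: nonneg)
  \<comment> \<open>Both expectations become literally the same integral against counting measure,
    so they agree for every \<open>f\<close>, including those whose integral takes the default value
    0.\<close>
  have count: "measure_pmf.expectation r f = (\<integral>x. pmf r x * f x \<partial>count_space UNIV)"
    for r and f :: "'a \<Rightarrow> real"
    by (subst measure_pmf_eq_density, subst integral_density) auto
  have "measure_pmf.expectation (embed_pmf ?g) f = measure_pmf.expectation p (\<lambda>x. w x * f x)"
    for f :: "'a \<Rightarrow> real"
    unfolding count pmf mult.assoc ..
  with pmf show ?thesis by (rule that)
qed

lemma strict_mono_on_interval:
  fixes y :: "nat \<Rightarrow> 'a::order"
  assumes "\<And>i. m \<le> i \<Longrightarrow> Suc i \<le> n \<Longrightarrow> y i < y (Suc i)"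
  shows "strict_mono_on {m..n} y"
proof (rule strict_mono_onI)
  fix i j assume "i \<in> {m..n}" "j \<in> {m..n}" "i < j"
  then have "m \<le> i" "j \<le> n" by auto
  from \<open>i < j\<close> \<open>j \<le> n\<close> show "y i < y j"
  proof (induction j)
    case (Suc j)
    have "y j < y (Suc j)" using assms[of j] Suc.prems \<open>m \<le> i\<close> by simp
    with Suc show ?case by (cases "i = j") auto
  qed simp
qed

context q_lattice
begin

lemma \<G>_D:
  assumes "X \<in> \<G> L M"
  shows "X \<in> extensional {1..M}" "i \<in> {1..M} \<Longrightarrow> X i \<in> L"
    "i \<in> {1..M} \<Longrightarrow> j \<in> {1..M} \<Longrightarrow> i < j \<Longrightarrow> X i < X j"
  using assms by (auto simp: \<G>_def strict_mono_on_def PiE_def)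

lemma interlaces_in_\<G>:
  assumes "X \<in> \<G> L (Suc N)" "Y \<in> extensional {1..N}"
    and "\<And>i. i \<in> {1..N} \<Longrightarrow> Y i \<in> I L (X i) (X (Suc i))"
  shows "Y \<in> \<G> L N"
proof -
  have "Y i < Y (Suc i)" if "1 \<le> i" "Suc i \<le> N" for i
    using assms(3)[of i] assms(3)[of "Suc i"] \<G>_D(2)[OF assms(1), of "Suc i"] that
    by (intro interlaced_less) auto
  then have "strict_mono_on {1..N} Y" by (rule strict_mono_on_interval)
  moreover have "Y i \<in> L" if "i \<in> {1..N}" for i
    using assms(3)[OF that] I_subset by blast
  ultimately show ?thesis
    using assms(2) by (simp add: \<G>_def PiE_def Pi_def)
qed

text \<open>Specified by its values instead of being built from a density over a box, so that it is
  meaningful independently of any box; existence is established once a box around \<open>X\<close>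
  is available.\<close>

definition link_pmf :: "nat \<Rightarrow> (nat \<Rightarrow> real) \<Rightarrow> (nat \<Rightarrow> real) pmf" where
  "link_pmf N X = (SOME p. \<forall>Y. pmf p Y = (if Y \<in> \<G> L N then link q L N X Y else 0))"

end

context q_lattice_box
begin

text \<open>The density of the row at \<open>X\<close> with respect to independent
  \<open>\<beta>\<close>-distributed coordinates. The weights of \<open>\<beta>\<close> already
  supply the factors \<open>|Y i|\<close>, and \<open>\<kappa> ^ N\<close> cancels their
  normalisation.\<close>

definition link_density :: "nat \<Rightarrow> (nat \<Rightarrow> real) \<Rightarrow> (nat \<Rightarrow> real) \<Rightarrow> real" where
  "link_density N X Y = q_pochhammer q q N / \<kappa> ^ N / vdm {1..Suc N} X *
     ((\<Prod>i\<in>{1..N}. of_bool (Y i \<in> I L (X i) (X (Suc i)))) * vdm {1..N} Y)"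

lemma link_density_nonneg: "0 \<le> link_density N X Y"
  unfolding link_density_def
  using vdm_nonneg q_pochhammer_pos[of N] \<kappa>_pos by (simp add: prod_nonneg)

lemma pmf_base_link_density:
  assumes X: "X \<in> \<G> L (Suc N)" and box: "\<And>i. i \<in> {1..Suc N} \<Longrightarrow> X i \<in> {b..a}"
  shows "pmf (Pi_pmf {1..N} undefined (\<lambda>_. \<beta>)) Y * link_density N X Y
    = (if Y \<in> \<G> L N then link q L N X Y else 0)"
proof (cases "Y \<in> extensional {1..N} \<and> interlaces L N Y X")
  case True
  then have Y: "Y i \<in> I L (X i) (X (Suc i))" if "i \<in> {1..N}" for i
    using that by (auto simp: interlaces_def)
  have YG: "Y \<in> \<G> L N"
    using True Y by (intro interlaces_in_\<G>[OF X]) blast+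
  \<comment> \<open>Intervals between points of the box stay in the box, where
    \<open>\<beta>\<close> has weight \<open>\<kappa> * |y|\<close>.\<close>
  have "Y i \<in> {b..a} \<inter> L" if "i \<in> {1..N}" for i
    using Y[OF that] I_subset[of "X i" "X (Suc i)"] box[of i] box[of "Suc i"] that by auto
  then have "pmf \<beta> (Y i) = \<bar>Y i\<bar> * \<kappa>" if "i \<in> {1..N}" for i
    using that by (simp add: pmf_\<beta> \<kappa>_def)
  then have "pmf (Pi_pmf {1..N} undefined (\<lambda>_. \<beta>)) Y = (\<Prod>i\<in>{1..N}. \<bar>Y i\<bar>) * \<kappa> ^ N"
    using True by (subst pmf_Pi) (auto simp: extensional_def prod.distrib)
  then show ?thesis
    using True YG Y \<kappa>_pos
    by (simp add: link_def link_density_def abs_vandermonde)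
next
  case False
  show ?thesis
  proof (cases "Y \<in> extensional {1..N}")
    case True
    then obtain i where "i \<in> {1..N}" "Y i \<notin> I L (X i) (X (Suc i))"
      using False by (auto simp: interlaces_def)
    then have "(\<Prod>i\<in>{1..N}. of_bool (Y i \<in> I L (X i) (X (Suc i)))) = (0 :: real)"
      by (intro prod_zero) auto
    then show ?thesis using False True by (simp only: link_density_def) (simp add: link_def)
  next
    case False
    then have "pmf (Pi_pmf {1..N} undefined (\<lambda>_. \<beta>)) Y = 0"
      by (intro pmf_Pi_outside) (auto simp: extensional_def)
    then show ?thesis using False \<G>_D(1) by auto
  qed
qed

lemma set_base_pmf:
  "finite A \<Longrightarrow> y \<in> set_pmf (Pi_pmf A d (\<lambda>_. \<beta>)) \<Longrightarrow> i \<in> A \<Longrightarrow> y i \<in> {b..a} \<inter> L"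
  by (auto simp: set_Pi_pmf PiE_dflt_def set_pmf_\<beta>)

lemma vdm_base_le:
  assumes "finite A" "y \<in> set_pmf (Pi_pmf A d (\<lambda>_. \<beta>))"
  shows "vdm A y \<le> (2 * max 1 R) ^ (card A)\<^sup>2"
proof (rule vdm_le)
  fix i assume "i \<in> A"
  with set_base_pmf[OF assms] abs_le_R[of "y i"] show "\<bar>y i\<bar> \<le> max 1 R" by (simp add: le_max_iff_disj)
qed (use assms in auto)

lemma prod_of_bool_bounds: "0 \<le> (\<Prod>i\<in>A. of_bool (P i) :: real)" "(\<Prod>i\<in>A. of_bool (P i)) \<le> (1 :: real)"
  by (auto intro!: prod_nonneg prod_le_1)

lemma integrable_interlaced_vdm:
  assumes "finite A"
  shows "integrable (measure_pmf (Pi_pmf A d (\<lambda>_. \<beta>))) (\<lambda>y. (\<Prod>i\<in>A. of_bool (P i y)) * vdm A y)"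
proof (rule integrable_bounded_pmf)
  fix y assume "y \<in> set_pmf (Pi_pmf A d (\<lambda>_. \<beta>))"
  from vdm_base_le[OF assms this]
  have "(\<Prod>i\<in>A. of_bool (P i y)) * vdm A y \<le> 1 * (2 * max 1 R) ^ (card A)\<^sup>2"
    using prod_of_bool_bounds vdm_nonneg by (intro mult_mono) auto
  then show "\<bar>(\<Prod>i\<in>A. of_bool (P i y)) * vdm A y\<bar> \<le> (2 * max 1 R) ^ (card A)\<^sup>2"
    using prod_of_bool_bounds(1)[of "\<lambda>i. P i y"] vdm_nonneg[of A y] by (simp add: abs_mult)
qed

lemma vdm_\<G>_pos:
  assumes "X \<in> \<G> L M" "A \<subseteq> {1..M}"
  shows "0 < vdm A X"
proof (rule vdm_pos)
  show "finite A" using assms(2) by (rule finite_subset) simp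
  have "inj_on X {1..M}" using assms(1) by (auto simp: \<G>_def intro: strict_mono_on_imp_inj_on)
  then show "inj_on X A" using assms(2) by (rule inj_on_subset)
qed

lemma
  assumes X: "X \<in> \<G> L (Suc N)" and box: "\<And>i. i \<in> {1..Suc N} \<Longrightarrow> X i \<in> {b..a}"
  shows pmf_link_pmf_box: "pmf (link_pmf N X) Y = (if Y \<in> \<G> L N then link q L N X Y else 0)"
    and expectation_link_pmf_box: "measure_pmf.expectation (link_pmf N X) (f :: _ \<Rightarrow> real)
      = measure_pmf.expectation (Pi_pmf {1..N} undefined (\<lambda>_. \<beta>)) (\<lambda>Y. link_density N X Y * f Y)"
proof -
  let ?base = "Pi_pmf {1..N} undefined (\<lambda>_. \<beta>)"
  \<comment> \<open>This is the stochasticity of the link: \<open>expectation_vdm\<close> over the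
    whole index range.\<close>
  have "measure_pmf.expectation ?base (link_density N X)
    = q_pochhammer q q N / \<kappa> ^ N / vdm {1..Suc N} X * (\<kappa> ^ N * vdm {1..Suc N} X / q_pochhammer q q N)"
    using expectation_vdm[of 1 N X undefined] box \<G>_D[OF X]
    by (simp add: link_density_def[abs_def] atLeastLessThanSuc_atLeastAtMost)
  also have "\<dots> = 1"
    using vdm_\<G>_pos[OF X, of "{1..Suc N}"] q_pochhammer_pos[of N] \<kappa>_pos by simp
  finally have one: "measure_pmf.expectation ?base (link_density N X) = 1" .
  have "integrable (measure_pmf ?base) (link_density N X)"
    unfolding link_density_def[abs_def] by (intro integrable_mult_right integrable_interlaced_vdm) auto
  from reweighted_pmf_exists[OF link_density_nonneg this one]
  obtain p where p: "\<And>Y. pmf p Y = pmf ?base Y * link_density N X Y"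
    "\<And>f :: _ \<Rightarrow> real. measure_pmf.expectation p f = measure_pmf.expectation ?base (\<lambda>Y. link_density N X Y * f Y)"
    by blast
  then have "\<forall>Y. pmf p Y = (if Y \<in> \<G> L N then link q L N X Y else 0)"
    using pmf_base_link_density[OF X box] by simp
  then have link: "\<forall>Y. pmf (link_pmf N X) Y = (if Y \<in> \<G> L N then link q L N X Y else 0)"
    unfolding link_pmf_def by (rule someI)
  then show "pmf (link_pmf N X) Y = (if Y \<in> \<G> L N then link q L N X Y else 0)" by blast
  have "link_pmf N X = p"
    using link \<open>\<forall>Y. pmf p Y = _ Y\<close> by (intro pmf_eqI) simp
  then show "measure_pmf.expectation (link_pmf N X) f
      = measure_pmf.expectation ?base (\<lambda>Y. link_density N X Y * f Y)"
    by (simp add: p(2))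
qed

end

context q_lattice
begin

text \<open>The inequalities are strict so that a sequence converging to a configuration of this
  size eventually enters the box.\<close>

lemma L_unbounded:
  obtains b a where "q_lattice_box q zp zm L b a" "\<And>r. \<bar>r\<bar> \<le> C \<Longrightarrow> b < r \<and> r < a"
proof -
  have "1 < inverse q" using q_pos q_less_1 by (simp add: one_less_inverse)
  from real_arch_pow[OF this] obtain n where n: "max (\<bar>C\<bar> / zp) (\<bar>C\<bar> / - zm) < inverse q ^ n" by blast
  have eq: "inverse q ^ n = q powi (- int n)" by (simp add: power_int_minus power_inverse)
  have "zm * q powi (- int n) < - \<bar>C\<bar>" "\<bar>C\<bar> < zp * q powi (- int n)"
    using n zp_pos zm_neg pos_divide_less_eq[of "- zm" "\<bar>C\<bar>" "q powi (- int n)"]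
    unfolding eq by (simp_all add: pos_divide_less_eq mult.commute)
  moreover have "q_lattice_box q zp zm L (zm * q powi (- int n)) (zp * q powi (- int n))"
    by unfold_locales (use q_pos zp_pos zm_neg in \<open>auto simp: L_eq two_sided_lattice_def mult_neg_pos\<close>)
  ultimately show ?thesis by (intro that) auto
qed

lemma pmf_link_pmf:
  assumes X: "X \<in> \<G> L (Suc N)"
  shows "pmf (link_pmf N X) Y = (if Y \<in> \<G> L N then link q L N X Y else 0)"
proof -
  obtain b a where box: "q_lattice_box q zp zm L b a"
    and le: "\<And>r. \<bar>r\<bar> \<le> Max ((\<lambda>i. \<bar>X i\<bar>) ` {1..Suc N}) \<Longrightarrow> b < r \<and> r < a"
    using L_unbounded by blast
  interpret q_lattice_box q zp zm L b a by (rule box)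
  show ?thesis
  proof (rule pmf_link_pmf_box[OF X])
    fix i assume "i \<in> {1..Suc N}"
    then have "\<bar>X i\<bar> \<le> Max ((\<lambda>i. \<bar>X i\<bar>) ` {1..Suc N})" by (intro Max_ge) auto
    then show "X i \<in> {b..a}" using le[of "X i"] by simp
  qed
qed

lemma set_link_pmf: "X \<in> \<G> L (Suc N) \<Longrightarrow> set_pmf (link_pmf N X) \<subseteq> \<G> L N"
  by (auto simp: set_pmf_iff pmf_link_pmf split: if_splits)

end

section \<open>Limits of configurations\<close>

lemma tendsto_fun_iff:
  fixes f :: "'b \<Rightarrow> 'i \<Rightarrow> 'a::topological_space"
  shows "(f \<longlongrightarrow> l) F \<longleftrightarrow> (\<forall>i. ((\<lambda>x. f x i) \<longlongrightarrow> l i) F)"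
  using limitin_componentwise[of "\<lambda>_. euclidean" UNIV f l F]
  by (simp add: euclidean_product_topology limitin_canonical_iff)

lemma closed_\<Delta>: "closed (\<Delta> M)"
  unfolding closed_sequential_limits
proof (intro allI impI, elim conjE)
  fix x l assume x: "\<forall>n. x n \<in> \<Delta> M" and "x \<longlonglongrightarrow> l"
  then have lim: "(\<lambda>n. x n i) \<longlonglongrightarrow> l i" for i by (simp add: tendsto_fun_iff)
  have "l i \<le> l j" if "i \<in> {1..M}" "j \<in> {1..M}" "i \<le> j" for i j
    using x that by (intro LIMSEQ_le[OF lim lim]) (auto simp: \<Delta>_def mono_on_def)
  moreover have "l i = undefined" if "i \<notin> {1..M}" for i
  \<comment> \<open>Extensionality survives limits: outside the index set all terms carry the same
    default value.\<close>
  proof (rule LIMSEQ_unique[OF lim])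
    have "x n i = undefined" for n
      using x that by (auto simp: \<Delta>_def PiE_def extensional_def)
    then show "(\<lambda>n. x n i) \<longlonglongrightarrow> undefined" by simp
  qed
  ultimately show "l \<in> \<Delta> M"
    by (auto simp: \<Delta>_def PiE_def extensional_def intro!: mono_onI)
qed

text \<open>Since the cone is closed, the relative closure is the closure in the whole function
  space, where it can be described by sequences.\<close>

lemma \<G>_closure_eq: "\<G>_closure L M = closure (\<G> L M)"
proof -
  have "\<G> L M \<subseteq> \<Delta> M"
    by (auto simp: \<G>_def \<Delta>_def PiE_def strict_mono_on_imp_mono_on)
  moreover from this have "closure (\<G> L M) \<subseteq> \<Delta> M"
    by (intro closure_minimal closed_\<Delta>)
  ultimately show ?thesis
    unfolding \<G>_closure_def by (auto simp: closure_of_subtopology Int_absorb1)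
qed

lemma \<G>_closure_iff: "X \<in> \<G>_closure L M \<longleftrightarrow> (\<exists>Xs. (\<forall>n. Xs n \<in> \<G> L M) \<and> Xs \<longlonglongrightarrow> X)"
  unfolding \<G>_closure_eq by (rule closure_sequential)

lemma \<G>_subset_closure: "\<G> L M \<subseteq> \<G>_closure L M"
  unfolding \<G>_closure_eq by (rule closure_subset)

lemma integrable_mult_bounded_pmf:
  fixes r :: "'a \<Rightarrow> real"
  assumes "integrable (measure_pmf p) r" "\<And>x. x \<in> set_pmf p \<Longrightarrow> \<bar>g x\<bar> \<le> C"
  shows "integrable (measure_pmf p) (\<lambda>x. r x * g x)"
proof (rule Bochner_Integration.integrable_bound)
  show "integrable (measure_pmf p) (\<lambda>x. C * r x)" using assms(1) by simp
  show "AE x in measure_pmf p. norm (r x * g x) \<le> norm (C * r x)"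
  proof (rule AE_pmfI)
    fix x assume "x \<in> set_pmf p"
    from assms(2)[OF this] have "\<bar>g x\<bar> \<le> \<bar>C\<bar>" by simp
    then show "norm (r x * g x) \<le> norm (C * r x)"
      by (simp add: abs_mult mult.commute[of "\<bar>C\<bar>"] mult_left_mono)
  qed
qed simp

lemma abs_expectation_density_le:
  fixes r :: "'a \<Rightarrow> real"
  assumes nonneg: "\<And>x. 0 \<le> r x" and int: "integrable (measure_pmf p) r"
    and one: "measure_pmf.expectation p r = 1"
    and le: "\<And>x. x \<in> set_pmf p \<Longrightarrow> r x \<noteq> 0 \<Longrightarrow> \<bar>g x\<bar> \<le> C"
  shows "\<bar>measure_pmf.expectation p (\<lambda>x. r x * g x)\<bar> \<le> C"
proof -
  have "\<bar>measure_pmf.expectation p (\<lambda>x. r x * g x)\<bar> \<le> measure_pmf.expectation p (\<lambda>x. \<bar>r x * g x\<bar>)"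
    by (rule integral_abs_bound)
  also have "\<dots> \<le> measure_pmf.expectation p (\<lambda>x. C * r x)"
  proof (rule integral_mono_AE')
    show "integrable (measure_pmf p) (\<lambda>x. C * r x)" using int by simp
    show "AE x in measure_pmf p. \<bar>r x * g x\<bar> \<le> C * r x"
    proof (rule AE_pmfI)
      fix x assume "x \<in> set_pmf p"
      then show "\<bar>r x * g x\<bar> \<le> C * r x"
        using le[of x] nonneg[of x] by (cases "r x = 0") (auto simp: abs_mult mult.commute[of C] intro: mult_left_mono)
    qed
    show "AE x in measure_pmf p. 0 \<le> C * r x"
    proof (rule AE_pmfI)
      fix x assume "x \<in> set_pmf p"
      then show "0 \<le> C * r x"
        using le[of x] nonneg[of x] by (cases "r x = 0") (auto intro!: mult_nonneg_nonneg)
    qed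
  qed
  finally show ?thesis using one by simp
qed

text \<open>The hypothesis on arbitrary choices of support points stands in for uniform convergence
  of \<open>g\<close> on the supports of \<open>r n\<close>: it can be applied to a sequence of bad
  points, should such points exist.\<close>

lemma expectation_concentrating:
  fixes r :: "nat \<Rightarrow> 'a \<Rightarrow> real"
  assumes nonneg: "\<And>n x. 0 \<le> r n x" and int: "\<And>n. integrable (measure_pmf p) (r n)"
    and one: "\<And>n. measure_pmf.expectation p (r n) = 1"
    and bound: "\<And>x. x \<in> set_pmf p \<Longrightarrow> \<bar>g x\<bar> \<le> C"
    and conv: "\<And>u. (\<And>n. u n \<in> set_pmf p) \<Longrightarrow> (\<And>n. r n (u n) \<noteq> 0) \<Longrightarrow> (\<lambda>n. g (u n)) \<longlonglongrightarrow> l"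
  shows "(\<lambda>n. measure_pmf.expectation p (\<lambda>x. r n x * g x)) \<longlonglongrightarrow> l"
proof (rule LIMSEQ_I)
  fix e :: real assume "0 < e"
  let ?ok = "\<lambda>n x. x \<in> set_pmf p \<and> r n x \<noteq> 0"
  have ex: "\<exists>x. ?ok n x" for n
  proof (rule ccontr)
    assume "\<nexists>x. ?ok n x"
    then have "measure_pmf.expectation p (r n) = 0"
      by (intro integral_eq_zero_AE AE_pmfI) auto
    with one show False by simp
  qed
  \<comment> \<open>The choice of \<open>u n\<close> deviates by at least \<open>e / 2\<close> as
    soon as any support point of \<open>r n\<close> does, so convergence along \<open>u\<close>
    excludes such points for large \<open>n\<close>.\<close>
  have "\<exists>x. ?ok n x \<and> ((\<exists>x. ?ok n x \<and> e / 2 \<le> \<bar>g x - l\<bar>) \<longrightarrow> e / 2 \<le> \<bar>g x - l\<bar>)" for n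
    using ex[of n] by blast
  then obtain u where u: "\<And>n. ?ok n (u n)"
    "\<And>n x. ?ok n x \<Longrightarrow> e / 2 \<le> \<bar>g x - l\<bar> \<Longrightarrow> e / 2 \<le> \<bar>g (u n) - l\<bar>"
    by metis
  have "(\<lambda>n. g (u n)) \<longlonglongrightarrow> l" using u(1) by (intro conv) auto
  then obtain n0 where n0: "\<And>n. n0 \<le> n \<Longrightarrow> \<bar>g (u n) - l\<bar> < e / 2"
    using LIMSEQ_D[of "\<lambda>n. g (u n)" l "e / 2"] \<open>0 < e\<close> by auto
  have "\<bar>measure_pmf.expectation p (\<lambda>x. r n x * g x) - l\<bar> < e" if "n0 \<le> n" for n
  proof -
    have "measure_pmf.expectation p (\<lambda>x. r n x * g x) - l
        = measure_pmf.expectation p (\<lambda>x. r n x * g x) - measure_pmf.expectation p (\<lambda>x. r n x * l)"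
      using one by simp
    also have "\<dots> = measure_pmf.expectation p (\<lambda>x. r n x * g x - r n x * l)"
      by (intro Bochner_Integration.integral_diff[symmetric] integrable_mult_bounded_pmf[OF int bound])
         (use int in auto)
    also have "\<dots> = measure_pmf.expectation p (\<lambda>x. r n x * (g x - l))"
      by (simp add: right_diff_distrib)
    also have "\<bar>\<dots>\<bar> \<le> e / 2"
    proof (rule abs_expectation_density_le[OF nonneg int one])
      fix x assume "x \<in> set_pmf p" "r n x \<noteq> 0"
      then show "\<bar>g x - l\<bar> \<le> e / 2" using u(2)[of x n] n0[OF that] by force
    qed
    finally show ?thesis using \<open>0 < e\<close> by linarith
  qed
  then show "\<exists>n0. \<forall>n\<ge>n0. norm (measure_pmf.expectation p (\<lambda>x. r n x * g x) - l) < e"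
    by auto
qed

context q_lattice
begin

lemma finite_tail_ge:
  assumes "0 < r"
  shows "finite {y \<in> tail c. r \<le> \<bar>y\<bar>}"
proof -
  have "(\<lambda>n. \<bar>c\<bar> * q ^ n) \<longlonglongrightarrow> \<bar>c\<bar> * 0"
    using q_pos q_less_1 by (intro tendsto_mult tendsto_const LIMSEQ_power_zero) auto
  then have "\<forall>\<^sub>F n in sequentially. \<bar>c\<bar> * q ^ n < r"
    using assms by (intro order_tendstoD(2)) auto
  then obtain n0 where "\<And>n. n0 \<le> n \<Longrightarrow> \<bar>c\<bar> * q ^ n < r"
    by (auto simp: eventually_sequentially)
  then have "{y \<in> tail c. r \<le> \<bar>y\<bar>} \<subseteq> (\<lambda>n. c * q ^ n) ` {..<n0}"
    using q_pos by (force simp: tail_def abs_mult not_less[symmetric])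
  then show ?thesis by (rule finite_subset) simp
qed

lemma finite_L_annulus:
  assumes "0 < r"
  shows "finite {y \<in> L. r \<le> \<bar>y\<bar> \<and> \<bar>y\<bar> \<le> C}"
proof -
  obtain b a where box: "q_lattice_box q zp zm L b a" and le: "\<And>r. \<bar>r\<bar> \<le> C \<Longrightarrow> b < r \<and> r < a"
    using L_unbounded by blast
  interpret q_lattice_box q zp zm L b a by (rule box)
  have "{y \<in> L. r \<le> \<bar>y\<bar> \<and> \<bar>y\<bar> \<le> C} \<subseteq> {y \<in> tail b. r \<le> \<bar>y\<bar>} \<union> {y \<in> tail a. r \<le> \<bar>y\<bar>}"
  proof
    fix y assume y: "y \<in> {y \<in> L. r \<le> \<bar>y\<bar> \<and> \<bar>y\<bar> \<le> C}"
    with le[of y] have "b < y" "y < a" by auto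
    then show "y \<in> {y \<in> tail b. r \<le> \<bar>y\<bar>} \<union> {y \<in> tail a. r \<le> \<bar>y\<bar>}"
      using y assms by (cases "0 < y") (auto simp: tail_pos[OF a_in a_pos] tail_neg[OF b_in b_neg])
  qed
  then show ?thesis by (rule finite_subset) (simp add: finite_tail_ge[OF assms])
qed

text \<open>Only finitely many lattice points lie in an annulus around 0 containing the limit, and a
  neighbourhood of the limit avoids all of them but the limit itself.\<close>

lemma eventually_eq_limit_L:
  assumes "\<And>n :: nat. y n \<in> L" "y \<longlonglongrightarrow> l" "l \<noteq> 0"
  shows "\<forall>\<^sub>F n in sequentially. y n = l" "l \<in> L"
proof -
  define F where "F = {y \<in> L. \<bar>l\<bar> / 2 \<le> \<bar>y\<bar> \<and> \<bar>y\<bar> \<le> 2 * \<bar>l\<bar>}"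
  have "finite F" unfolding F_def using assms(3) by (intro finite_L_annulus) auto
  have "(\<lambda>n. \<bar>y n\<bar>) \<longlonglongrightarrow> \<bar>l\<bar>" using assms(2) by (rule tendsto_rabs)
  then have "\<forall>\<^sub>F n in sequentially. \<bar>l\<bar> / 2 < \<bar>y n\<bar>" "\<forall>\<^sub>F n in sequentially. \<bar>y n\<bar> < 2 * \<bar>l\<bar>"
    using assms(3) by (auto intro: order_tendstoD simp del: less_divide_eq_numeral1 divide_less_eq_numeral1)
  moreover have "\<forall>\<^sub>F n in sequentially. y n \<in> - (F - {l})"
  proof (rule topological_tendstoD[OF assms(2)])
    have "closed (F - {l})" using \<open>finite F\<close> by (simp add: finite_imp_closed)
    then show "open (- (F - {l}))" by (rule open_Compl)
  qed simp
  ultimately show ev: "\<forall>\<^sub>F n in sequentially. y n = l"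
    by eventually_elim (use assms(1) in \<open>auto simp: F_def\<close>)
  show "l \<in> L"
    using eventually_happens'[OF sequentially_bot ev] assms(1) by auto
qed

lemma \<G>_limit:
  assumes "\<And>n. Xs n \<in> \<G> L M" "Xs \<longlonglongrightarrow> X" "i \<in> {1..M}"
  shows "X i \<noteq> 0 \<Longrightarrow> X i \<in> L" "X i \<noteq> 0 \<Longrightarrow> \<forall>\<^sub>F n in sequentially. Xs n i = X i"
  using eventually_eq_limit_L[of "\<lambda>n. Xs n i" "X i"] assms \<G>_D(2)[OF assms(1,3)]
  by (auto simp: tendsto_fun_iff)

lemma \<G>_closure_D:
  assumes "X \<in> \<G>_closure L M"
  shows "X \<in> {1..M} \<rightarrow>\<^sub>E insert 0 L" "i \<in> {1..M} \<Longrightarrow> j \<in> {1..M} \<Longrightarrow> i \<le> j \<Longrightarrow> X i \<le> X j"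
proof -
  have \<Delta>: "X \<in> \<Delta> M" using assms by (auto simp: \<G>_closure_def closure_of_def)
  then show "i \<in> {1..M} \<Longrightarrow> j \<in> {1..M} \<Longrightarrow> i \<le> j \<Longrightarrow> X i \<le> X j"
    by (auto simp: \<Delta>_def mono_on_def)
  obtain Xs where "\<And>n. Xs n \<in> \<G> L M" "Xs \<longlonglongrightarrow> X" using assms by (auto simp: \<G>_closure_iff)
  from \<G>_limit(1)[OF this] \<Delta> show "X \<in> {1..M} \<rightarrow>\<^sub>E insert 0 L"
    unfolding \<Delta>_def PiE_def Pi_def by blast
qed

text \<open>Countability makes every subset of the closure Borel, so that measures on it are
  determined by their point masses.\<close>

lemma countable_\<G>_closure: "countable (\<G>_closure L M)"
proof (rule countable_subset)
  show "\<G>_closure L M \<subseteq> {1..M} \<rightarrow>\<^sub>E insert 0 L" using \<G>_closure_D(1) by blast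
  show "countable ({1..M} \<rightarrow>\<^sub>E insert 0 L)" by (intro countable_PiE) (auto simp: countable_L)
qed

end

section \<open>Links near a configuration with a multiple zero\<close>

context q_lattice
begin

text \<open>An endpoint near 0 only affects lattice points that are no larger in modulus. With an
  endpoint equal to 0 the formula for \<open>I\<close> gives the right limit,
  \<open>c \<le> y < 0\<close> or \<open>0 < y \<le> d\<close>, because \<open>L\<close> omits
  0.\<close>

lemma I_eq_limit:
  assumes "c' < d'" "c \<le> d" "c \<noteq> 0 \<or> d \<noteq> 0" "c \<noteq> 0 \<Longrightarrow> c' = c" "d \<noteq> 0 \<Longrightarrow> d' = d"
    and "c = 0 \<Longrightarrow> \<bar>c'\<bar> < \<bar>y\<bar>" "d = 0 \<Longrightarrow> \<bar>d'\<bar> < \<bar>y\<bar>" "y \<in> L"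
  shows "y \<in> I L c' d' \<longleftrightarrow> y \<in> I L c d"
proof -
  consider "c \<noteq> 0" "d \<noteq> 0" | "c \<noteq> 0" "d = 0" | "c = 0" "d \<noteq> 0"
    using assms(3) by blast
  then show ?thesis
  proof cases
    case 1
    then show ?thesis using assms(4,5) by simp
  next
    case 2
    have "c' = c" "c < 0" "\<bar>d'\<bar> < \<bar>y\<bar>" using assms(2,4,7) 2 by auto
    then have "y \<in> I L c' d' \<longleftrightarrow> c \<le> y \<and> y < 0" "y \<in> I L c d \<longleftrightarrow> c \<le> y \<and> y < 0"
      using 2 L_nonzero[OF assms(8)] assms(8) by (auto simp: I_def)
    then show ?thesis by simp
  next
    case 3
    have "d' = d" "0 < d" "\<bar>c'\<bar> < \<bar>y\<bar>" using assms(2,5,6) 3 by auto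
    then have "y \<in> I L c' d' \<longleftrightarrow> 0 < y \<and> y \<le> d" "y \<in> I L c d \<longleftrightarrow> 0 < y \<and> y \<le> d"
      using 3 L_nonzero[OF assms(8)] assms(8) by (auto simp: I_def)
    then show ?thesis by simp
  qed
qed

end

text \<open>The box constraint and the equalities hold for every \<open>n\<close>, not merely
  eventually; dropping an initial segment of a convergent sequence leads to this situation.\<close>

locale degenerating = q_lattice_box +
  fixes N :: nat and X :: "nat \<Rightarrow> real" and Xs :: "nat \<Rightarrow> nat \<Rightarrow> real"
  assumes Xs_in: "\<And>n. Xs n \<in> \<G> L (Suc N)"
    and Xs_box: "\<And>n i. i \<in> {1..Suc N} \<Longrightarrow> Xs n i \<in> {b..a}"
    and Xs_eq: "\<And>n i. i \<in> {1..Suc N} \<Longrightarrow> X i \<noteq> 0 \<Longrightarrow> Xs n i = X i"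
    and Xs_lim: "Xs \<longlonglongrightarrow> X"
begin

text \<open>
  \<open>Z\<close> indexes the coordinates of \<open>Y\<close> forced to 0 by \<open>X\<close>, and \<open>Z0\<close> the zero coordinates of \<open>X\<close>;
  \<open>card Z0 = card Z + 1\<close> unless both are empty. \<open>\<theta>\<close> normalises the link on the indices \<open>Z\<close>.
\<close>

definition "Z0 = {i \<in> {1..Suc N}. X i = 0}"
definition "B0 = {1..Suc N} - Z0"
definition "Z = {i \<in> {1..N}. X i = 0 \<and> X (Suc i) = 0}"
definition "B = {1..N} - Z"

definition glue :: "(nat \<Rightarrow> real) \<Rightarrow> (nat \<Rightarrow> real) \<Rightarrow> nat \<Rightarrow> real" where
  "glue v u = (\<lambda>i. if i \<in> B then v i else u i)"

text \<open>The value \<open>undefined\<close> off \<open>Z\<close> keeps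
  \<open>glue v zeros\<close> extensional on \<open>{1..N}\<close>.\<close>

definition zeros :: "nat \<Rightarrow> real" where
  "zeros = (\<lambda>i. if i \<in> Z then 0 else undefined)"

definition "U = Pi_pmf Z undefined (\<lambda>_. \<beta>)"
definition "V = Pi_pmf B undefined (\<lambda>_. \<beta>)"

definition \<theta> :: real where "\<theta> = q_pochhammer q q (card Z) / \<kappa> ^ card Z"

text \<open>The denominator \<open>vdm Z0 (Xs n)\<close> is the only factor of
  \<open>vdm {1..Suc N} (Xs n)\<close> that can tend to 0; placing it here confines the singularity
  to a density of mass 1.\<close>

definition small_density :: "nat \<Rightarrow> (nat \<Rightarrow> real) \<Rightarrow> real" where
  "small_density n u = \<theta> / vdm Z0 (Xs n) *
     ((\<Prod>i\<in>Z. of_bool (u i \<in> I L (Xs n i) (Xs n (Suc i)))) * vdm Z u)"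

definition cross :: "(nat \<Rightarrow> real) \<Rightarrow> (nat \<Rightarrow> real) \<Rightarrow> real" where
  "cross v u = (\<Prod>i\<in>B. \<Prod>j\<in>Z. \<bar>v i - u j\<bar>)"

text \<open>What remains of the normalisation once \<open>\<theta>\<close> and \<open>vdm Z0\<close>
  have gone to \<open>small_density\<close>. It depends on \<open>x\<close> only through the
  distances from merging coordinates to the others, whose limits are nonzero, so one formula serves
  both \<open>Xs n\<close> and \<open>X\<close>.\<close>

definition big_const :: "(nat \<Rightarrow> real) \<Rightarrow> real" where
  "big_const x = q_pochhammer q q N / \<kappa> ^ N / \<theta> / (vdm B0 X * (\<Prod>i\<in>Z0. \<Prod>j\<in>B0. \<bar>x i - X j\<bar>))"

definition big_density :: "(nat \<Rightarrow> real) \<Rightarrow> (nat \<Rightarrow> real) \<Rightarrow> real" where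
  "big_density x v = big_const x * ((\<Prod>i\<in>B. of_bool (v i \<in> I L (x i) (x (Suc i)))) * vdm B v)"

lemma finite_sets [simp]: "finite Z0" "finite B0" "finite Z" "finite B"
  by (auto simp: Z0_def B0_def Z_def B_def)

lemma splits: "{1..N} = B \<union> Z" "B \<inter> Z = {}" "{1..Suc N} = Z0 \<union> B0" "Z0 \<inter> B0 = {}"
  by (auto simp: Z0_def B0_def Z_def B_def)

lemma X_closure: "X \<in> \<G>_closure L (Suc N)"
  using Xs_in Xs_lim by (auto simp: \<G>_closure_iff)

lemma X_le: "i \<in> {1..Suc N} \<Longrightarrow> j \<in> {1..Suc N} \<Longrightarrow> i \<le> j \<Longrightarrow> X i \<le> X j"
  by (rule \<G>_closure_D(2)[OF X_closure])

lemma Xs_lim_at: "(\<lambda>n. Xs n i) \<longlonglongrightarrow> X i"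
  using Xs_lim by (simp add: tendsto_fun_iff)

lemma \<theta>_pos: "0 < \<theta>"
  unfolding \<theta>_def using q_pochhammer_pos \<kappa>_pos by simp

lemma vdm_Z0_pos: "0 < vdm Z0 (Xs n)"
  by (rule vdm_\<G>_pos[OF Xs_in]) (auto simp: Z0_def)

lemma vdm_B0_Xs: "vdm B0 (Xs n) = vdm B0 X"
  by (rule vdm_cong) (auto simp: B0_def Z0_def intro!: Xs_eq)

lemma vdm_B0_pos: "0 < vdm B0 X"
  unfolding vdm_B0_Xs[of 0, symmetric] by (rule vdm_\<G>_pos[OF Xs_in]) (auto simp: B0_def)

text \<open>As \<open>X\<close> is nondecreasing, its zeros have consecutive indices.
  \<open>Z\<close> omits the last of them, since it asks for the next coordinate to vanish
  too.\<close>

lemma zero_interval: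
  assumes "Z0 \<noteq> {}"
  obtains s where "1 \<le> s" "Z0 = {s..s + card Z}" "Z = {s..<s + card Z}"
proof -
  define s t where "s = Min Z0" and "t = Max Z0"
  have st: "s \<in> Z0" "t \<in> Z0" using assms by (simp_all add: s_def t_def)
  have Z0: "Z0 = {s..t}"
  proof (intro equalityI subsetI)
    fix i assume i: "i \<in> {s..t}"
    have s: "s \<in> {1..Suc N}" "X s = 0" and t: "t \<in> {1..Suc N}" "X t = 0"
      using st by (simp_all add: Z0_def)
    have i': "i \<in> {1..Suc N}" using i s(1) t(1) by auto
    have "X s \<le> X i" using i i' s(1) by (intro X_le) auto
    moreover have "X i \<le> X t" using i i' t(1) by (intro X_le) auto
    ultimately show "i \<in> Z0" using i' s(2) t(2) by (simp add: Z0_def)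
  next
    fix i assume "i \<in> Z0"
    then show "i \<in> {s..t}" by (simp add: s_def t_def)
  qed
  have "Z = {i. i \<in> Z0 \<and> Suc i \<in> Z0}"
    by (auto simp: Z_def Z0_def)
  also have "\<dots> = {s..<t}" unfolding Z0 by auto
  finally have Z: "Z = {s..<t}" .
  have "s \<le> t" using st(1) unfolding Z0 by simp
  have "1 \<le> s" using st(1) by (simp add: Z0_def)
  have "card Z = t - s" unfolding Z by (rule card_atLeastLessThan)
  then have t: "s + card Z = t" using \<open>s \<le> t\<close> by linarith
  show ?thesis
    by (rule that[of s]; (unfold t)?) (fact \<open>1 \<le> s\<close> Z0 Z)+
qed

lemma expectation_small_density: "measure_pmf.expectation U (small_density n) = 1"
proof -
  have "measure_pmf.expectation U
      (\<lambda>u. (\<Prod>i\<in>Z. of_bool (u i \<in> I L (Xs n i) (Xs n (Suc i)))) * vdm Z u)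
    = \<kappa> ^ card Z * vdm Z0 (Xs n) / q_pochhammer q q (card Z)"
  proof (cases "Z0 = {}")
    case True
    then have "Z = {}" by (auto simp: Z_def Z0_def)
    with True show ?thesis by (simp add: U_def vdm_small q_pochhammer_def)
  next
    case False
    obtain s where s: "1 \<le> s" "Z0 = {s..s + card Z}" "Z = {s..<s + card Z}"
      using zero_interval[OF False] by blast
    have "s + card Z \<in> Z0" by (subst s(2)) simp
    then have "s + card Z \<le> Suc N" by (simp add: Z0_def)
    with s have "measure_pmf.expectation (Pi_pmf {s..<s + card Z} undefined (\<lambda>_. \<beta>))
      (\<lambda>u. (\<Prod>i\<in>{s..<s + card Z}. of_bool (u i \<in> I L (Xs n i) (Xs n (Suc i)))) * vdm {s..<s + card Z} u)
    = \<kappa> ^ card Z * vdm {s..s + card Z} (Xs n) / q_pochhammer q q (card Z)"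
      using \<G>_D(2,3)[OF Xs_in] Xs_box by (intro expectation_vdm) auto
    then show ?thesis unfolding U_def s(2)[symmetric] s(3)[symmetric] .
  qed
  then show ?thesis
    using \<theta>_pos vdm_Z0_pos[of n] q_pochhammer_pos[of "card Z"] \<kappa>_pos
    unfolding small_density_def[abs_def] by (simp add: \<theta>_def)
qed

lemma small_density_nonneg: "0 \<le> small_density n u"
  unfolding small_density_def using \<theta>_pos vdm_nonneg by (simp add: prod_nonneg)

lemma integrable_small_density: "integrable (measure_pmf U) (small_density n)"
  unfolding small_density_def[abs_def] U_def
  by (intro integrable_mult_right integrable_interlaced_vdm) simp

text \<open>Both Vandermonde products split by \<open>vdm_union\<close>: the mixed pairs of
  \<open>Y\<close> become \<open>cross\<close>, those of \<open>X\<close> enter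
  \<open>big_const\<close>.\<close>

lemma link_density_glue:
  "link_density N (Xs n) (glue v u) = big_density (Xs n) v * (small_density n u * cross v u)"
proof -
  have vdm_glue: "vdm {1..N} (glue v u) = vdm B v * vdm Z u * cross v u"
  proof -
    have "vdm B (glue v u) = vdm B v" "vdm Z (glue v u) = vdm Z u"
      using splits(2) by (auto intro!: vdm_cong simp: glue_def)
    moreover have "(\<Prod>i\<in>B. \<Prod>j\<in>Z. \<bar>glue v u i - glue v u j\<bar>) = cross v u"
      using splits(2) unfolding cross_def by (intro prod.cong) (auto simp: glue_def)
    ultimately show ?thesis
      unfolding splits(1) by (subst vdm_union) (use splits(2) in auto)
  qed
  have ind: "(\<Prod>i\<in>{1..N}. of_bool (glue v u i \<in> I L (Xs n i) (Xs n (Suc i))))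
    = (\<Prod>i\<in>B. of_bool (v i \<in> I L (Xs n i) (Xs n (Suc i))))
      * (\<Prod>i\<in>Z. of_bool (u i \<in> I L (Xs n i) (Xs n (Suc i))) :: real)"
  proof -
    have "(\<Prod>i\<in>B. of_bool (glue v u i \<in> I L (Xs n i) (Xs n (Suc i))))
        = (\<Prod>i\<in>B. of_bool (v i \<in> I L (Xs n i) (Xs n (Suc i))) :: real)"
      "(\<Prod>i\<in>Z. of_bool (glue v u i \<in> I L (Xs n i) (Xs n (Suc i))))
        = (\<Prod>i\<in>Z. of_bool (u i \<in> I L (Xs n i) (Xs n (Suc i))) :: real)"
      using splits(2) by (auto intro!: prod.cong simp: glue_def)
    then show ?thesis
      unfolding splits(1) using splits(2) by (subst prod.union_disjoint) simp_all
  qed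
  have vdm_Xs: "vdm {1..Suc N} (Xs n) = vdm Z0 (Xs n) * vdm B0 X * (\<Prod>i\<in>Z0. \<Prod>j\<in>B0. \<bar>Xs n i - X j\<bar>)"
  proof -
    have "(\<Prod>i\<in>Z0. \<Prod>j\<in>B0. \<bar>Xs n i - Xs n j\<bar>) = (\<Prod>i\<in>Z0. \<Prod>j\<in>B0. \<bar>Xs n i - X j\<bar>)"
      by (intro prod.cong) (auto simp: B0_def Z0_def Xs_eq)
    then show ?thesis
      unfolding splits(3) by (subst vdm_union) (use splits(4) in \<open>auto simp: vdm_B0_Xs\<close>)
  qed
  show ?thesis
    unfolding link_density_def big_density_def small_density_def big_const_def vdm_glue ind vdm_Xs
    using \<theta>_pos by (simp add: mult_ac)
qed

text \<open>The squeezed coordinates are integrated out with \<open>v\<close> frozen; what remains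
  is an integral against \<open>V\<close>, a measure independent of \<open>n\<close>.\<close>

definition averaged :: "((nat \<Rightarrow> real) \<Rightarrow> real) \<Rightarrow> nat \<Rightarrow> (nat \<Rightarrow> real) \<Rightarrow> real" where
  "averaged f n v = measure_pmf.expectation U (\<lambda>u. small_density n u * (cross v u * f (glue v u)))"

lemma cross_le:
  assumes "v \<in> set_pmf V" "u \<in> set_pmf U"
  shows "0 \<le> cross v u" "cross v u \<le> (\<Prod>i\<in>B. \<Prod>j\<in>Z. 2 * R)"
proof -
  have "\<bar>v i - u j\<bar> \<le> 2 * R" if "i \<in> B" "j \<in> Z" for i j
    using set_base_pmf[OF finite_sets(4) assms(1)[unfolded V_def] that(1)]
      set_base_pmf[OF finite_sets(3) assms(2)[unfolded U_def] that(2)]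
      abs_le_R[of "v i"] abs_le_R[of "u j"] by auto
  then show "cross v u \<le> (\<Prod>i\<in>B. \<Prod>j\<in>Z. 2 * R)"
    unfolding cross_def by (intro prod_mono conjI prod_nonneg) auto
  show "0 \<le> cross v u" by (simp add: cross_def prod_nonneg)
qed

end

context degenerating
begin

lemma base_eq_glue:
  "Pi_pmf {1..N} undefined (\<lambda>_. \<beta>) = map_pmf (\<lambda>z. glue (fst z) (snd z)) (pair_pmf V U)"
  unfolding splits(1) U_def V_def
  by (subst Pi_pmf_union) (use splits(2) in \<open>auto simp: glue_def[abs_def] case_prod_unfold\<close>)

lemma expectation_link_eq_averaged:
  assumes f: "\<And>Y. \<bar>f Y\<bar> \<le> M"
  shows "measure_pmf.expectation (link_pmf N (Xs n)) f
    = measure_pmf.expectation V (\<lambda>v. big_density (Xs n) v * averaged f n v)"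
proof -
  let ?base = "Pi_pmf {1..N} undefined (\<lambda>_. \<beta>)"
  \<comment> \<open>This bound may depend on \<open>n\<close>, as it only justifies Fubini for one
    fixed \<open>n\<close>.\<close>
  define c where "c = \<bar>q_pochhammer q q N / \<kappa> ^ N / vdm {1..Suc N} (Xs n)\<bar>"
  have bound: "\<bar>link_density N (Xs n) Y * f Y\<bar> \<le> c * (1 * (2 * max 1 R) ^ (card {1..N})\<^sup>2) * M"
    if "Y \<in> set_pmf ?base" for Y
  proof -
    let ?p = "\<Prod>i\<in>{1..N}. of_bool (Y i \<in> I L (Xs n i) (Xs n (Suc i))) :: real"
    have "?p * vdm {1..N} Y \<le> 1 * (2 * max 1 R) ^ (card {1..N})\<^sup>2"
      by (intro mult_mono vdm_base_le[OF _ that] prod_of_bool_bounds(2) vdm_nonneg) simp_all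
    moreover have "0 \<le> ?p * vdm {1..N} Y"
      by (intro mult_nonneg_nonneg vdm_nonneg prod_of_bool_bounds(1))
    ultimately have "\<bar>?p * vdm {1..N} Y\<bar> \<le> 1 * (2 * max 1 R) ^ (card {1..N})\<^sup>2"
      by (simp only: abs_of_nonneg)
    then have "c * \<bar>?p * vdm {1..N} Y\<bar> * \<bar>f Y\<bar> \<le> c * (1 * (2 * max 1 R) ^ (card {1..N})\<^sup>2) * M"
      by (intro mult_mono f mult_left_mono) (simp_all add: c_def)
    then show ?thesis unfolding link_density_def c_def abs_mult .
  qed
  have "measure_pmf.expectation (link_pmf N (Xs n)) f
      = measure_pmf.expectation (pair_pmf V U)
          (\<lambda>z. link_density N (Xs n) (glue (fst z) (snd z)) * f (glue (fst z) (snd z)))"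
    by (subst expectation_link_pmf_box[OF Xs_in Xs_box], assumption, unfold base_eq_glue, simp)
  also have "\<dots> = measure_pmf.expectation V (\<lambda>v. measure_pmf.expectation U
      (\<lambda>u. link_density N (Xs n) (glue v u) * f (glue v u)))"
  proof (rule expectation_pair_pmf)
    fix v u assume "v \<in> set_pmf V" "u \<in> set_pmf U"
    then have "(v, u) \<in> set_pmf (pair_pmf V U)" by simp
    then have "glue v u \<in> set_pmf ?base"
      unfolding base_eq_glue set_map_pmf by (intro image_eqI[where x="(v, u)"]) auto
    then show "\<bar>link_density N (Xs n) (glue v u) * f (glue v u)\<bar>
        \<le> c * (1 * (2 * max 1 R) ^ (card {1..N})\<^sup>2) * M" by (rule bound)
  qed
  also have "\<dots> = measure_pmf.expectation V (\<lambda>v. big_density (Xs n) v * averaged f n v)"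
    unfolding link_density_glue averaged_def mult.assoc by simp
  finally show ?thesis .
qed

lemma big_const_tendsto: "(\<lambda>n. big_const (Xs n)) \<longlonglongrightarrow> big_const X"
proof -
  have "(\<Prod>i\<in>Z0. \<Prod>j\<in>B0. \<bar>X i - X j\<bar>) \<noteq> 0"
    by (auto simp: Z0_def B0_def)
  then show ?thesis
    unfolding big_const_def using vdm_B0_pos
    by (intro tendsto_intros Xs_lim_at) auto
qed

lemma big_const_nonneg: "0 \<le> big_const X"
  unfolding big_const_def using q_pochhammer_pos[of N] \<kappa>_pos \<theta>_pos vdm_B0_pos
  by (intro divide_nonneg_nonneg mult_nonneg_nonneg prod_nonneg zero_le_power) auto

lemma big_density_nonneg: "0 \<le> big_density X v"
  unfolding big_density_def
  by (intro mult_nonneg_nonneg big_const_nonneg vdm_nonneg prod_of_bool_bounds(1))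

text \<open>Uniformity in \<open>n\<close> comes from the convergence of
  \<open>big_const (Xs n)\<close>; it supplies the dominating constant for the integral over
  \<open>V\<close>.\<close>

lemma big_density_bounded:
  "\<exists>C\<ge>0. \<forall>n. \<forall>v\<in>set_pmf V. \<bar>big_density (Xs n) v\<bar> \<le> C"
proof -
  from convergent_imp_Bseq[OF convergentI[OF big_const_tendsto]]
  obtain C0 where C0: "0 < C0" "\<And>n. \<bar>big_const (Xs n)\<bar> \<le> C0" by (auto simp: Bseq_def)
  let ?C = "C0 * (1 * (2 * max 1 R) ^ (card B)\<^sup>2)"
  have le: "\<bar>big_density x v\<bar> \<le> ?C" if "v \<in> set_pmf V" "\<bar>big_const x\<bar> \<le> C0" for x v
  proof -
    let ?p = "\<Prod>i\<in>B. of_bool (v i \<in> I L (x i) (x (Suc i))) :: real"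
    have "?p * vdm B v \<le> 1 * (2 * max 1 R) ^ (card B)\<^sup>2"
      by (intro mult_mono vdm_base_le[OF _ that(1)[unfolded V_def]] prod_of_bool_bounds(2) vdm_nonneg) simp_all
    moreover have "0 \<le> ?p * vdm B v"
      by (intro mult_nonneg_nonneg vdm_nonneg prod_of_bool_bounds(1))
    ultimately have "\<bar>big_const x\<bar> * (?p * vdm B v) \<le> ?C"
      using C0(1) by (intro mult_mono[OF that(2)]) simp_all
    with \<open>0 \<le> ?p * vdm B v\<close> show ?thesis
      unfolding big_density_def abs_mult[of "big_const x"] by (simp only: abs_of_nonneg)
  qed
  show ?thesis
    by (rule exI[of _ ?C]) (use C0 le in auto)
qed

text \<open>For \<open>i\<close> in \<open>B\<close> at most one endpoint tends to 0, and it
  eventually lies closer to 0 than the fixed nonzero value \<open>v i\<close>. The threshold depends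
  on \<open>v\<close>, which suffices for pointwise convergence.\<close>

lemma eventually_interlaced_eq:
  assumes "v \<in> set_pmf V"
  shows "\<forall>\<^sub>F n in sequentially. \<forall>i\<in>B.
    v i \<in> I L (Xs n i) (Xs n (Suc i)) \<longleftrightarrow> v i \<in> I L (X i) (X (Suc i))"
proof (rule eventually_ball_finite)
  show "\<forall>i\<in>B. \<forall>\<^sub>F n in sequentially.
    v i \<in> I L (Xs n i) (Xs n (Suc i)) \<longleftrightarrow> v i \<in> I L (X i) (X (Suc i))"
  proof
    fix i assume "i \<in> B"
    then have i: "i \<in> {1..Suc N}" "Suc i \<in> {1..Suc N}" "X i \<noteq> 0 \<or> X (Suc i) \<noteq> 0"
      by (auto simp: B_def Z_def)
    have v: "v i \<in> L"
      using set_base_pmf[OF finite_sets(4) assms[unfolded V_def] \<open>i \<in> B\<close>] by simp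
    have ev: "\<forall>\<^sub>F n in sequentially. X j = 0 \<longrightarrow> \<bar>Xs n j\<bar> < \<bar>v i\<bar>" for j
    proof (cases "X j = 0")
      case True
      then have "(\<lambda>n. \<bar>Xs n j\<bar>) \<longlonglongrightarrow> 0"
        using Xs_lim_at[of j] by (simp add: tendsto_rabs_zero)
      then have "\<forall>\<^sub>F n in sequentially. \<bar>Xs n j\<bar> < \<bar>v i\<bar>"
        using L_nonzero[OF v] by (intro order_tendstoD(2)) auto
      then show ?thesis by eventually_elim simp
    qed simp
    show "\<forall>\<^sub>F n in sequentially.
      v i \<in> I L (Xs n i) (Xs n (Suc i)) \<longleftrightarrow> v i \<in> I L (X i) (X (Suc i))"
      using ev[of i] ev[of "Suc i"]
    proof eventually_elim
      case (elim n)
      have "Xs n i < Xs n (Suc i)" using \<G>_D(3)[OF Xs_in i(1,2)] by simp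
      moreover have "X i \<le> X (Suc i)" using i by (intro X_le) auto
      ultimately show ?case
        using elim i(3) Xs_eq[OF i(1)] Xs_eq[OF i(2)] v by (intro I_eq_limit) blast+
    qed
  qed
qed simp

lemma big_density_tendsto:
  assumes "v \<in> set_pmf V"
  shows "(\<lambda>n. big_density (Xs n) v) \<longlonglongrightarrow> big_density X v"
  unfolding big_density_def
proof (intro tendsto_mult big_const_tendsto tendsto_const)
  let ?p = "\<lambda>x. \<Prod>i\<in>B. of_bool (v i \<in> I L (x i) (x (Suc i))) :: real"
  have "\<forall>\<^sub>F n in sequentially. ?p (Xs n) = ?p X"
    using eventually_interlaced_eq[OF assms] by eventually_elim (auto intro!: prod.cong)
  then show "(\<lambda>n. ?p (Xs n)) \<longlonglongrightarrow> ?p X" by (rule tendsto_eventually)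
qed

lemma big_density_nonzeroD: "big_density x v \<noteq> 0 \<Longrightarrow> i \<in> B \<Longrightarrow> v i \<in> I L (x i) (x (Suc i))"
  by (auto simp: big_density_def prod_zero_iff split: if_splits)

lemma small_density_nonzeroD:
  "small_density n u \<noteq> 0 \<Longrightarrow> i \<in> Z \<Longrightarrow> u i \<in> I L (Xs n i) (Xs n (Suc i))"
  by (auto simp: small_density_def prod_zero_iff split: if_splits)

text \<open>Support points of the small density are squeezed between coordinates of
  \<open>Xs n\<close> tending to 0. Membership in \<open>\<G> L N\<close> is recorded because test
  functions are continuous only on its closure.\<close>

lemma glue_limit:
  assumes v: "v \<in> set_pmf V" "\<forall>i\<in>B. v i \<in> I L (X i) (X (Suc i))"
    and u: "\<And>n. u n \<in> set_pmf U" "\<And>n. small_density n (u n) \<noteq> 0"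
  shows "\<forall>\<^sub>F n in sequentially. glue v (u n) \<in> \<G> L N"
    and "(\<lambda>n. glue v (u n)) \<longlonglongrightarrow> glue v zeros"
    and "(\<lambda>n. cross v (u n)) \<longlonglongrightarrow> cross v zeros"
proof -
  have outside: "u n i = undefined" if "i \<notin> Z" for n i
    using set_Pi_pmf_subset[of Z undefined "\<lambda>_. \<beta>"] u(1)[of n] that by (auto simp: U_def)
  have u_lim: "(\<lambda>n. u n i) \<longlonglongrightarrow> 0" if "i \<in> Z" for i
  proof (rule tendsto_rabs_zero_cancel, rule tendsto_sandwich[OF _ _ tendsto_const])
    have "X i = 0" "X (Suc i) = 0" using that by (auto simp: Z_def)
    then show "(\<lambda>n. max \<bar>Xs n i\<bar> \<bar>Xs n (Suc i)\<bar>) \<longlonglongrightarrow> 0"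
      using tendsto_max[OF tendsto_rabs[OF Xs_lim_at[of i]] tendsto_rabs[OF Xs_lim_at[of "Suc i"]]] by simp
    have "\<bar>u n i\<bar> \<le> max \<bar>Xs n i\<bar> \<bar>Xs n (Suc i)\<bar>" for n
      using small_density_nonzeroD[OF u(2) that, of n] I_subset[of "Xs n i" "Xs n (Suc i)"] by force
    then show "\<forall>\<^sub>F n in sequentially. \<bar>u n i\<bar> \<le> max \<bar>Xs n i\<bar> \<bar>Xs n (Suc i)\<bar>" by simp
  qed simp
  show "(\<lambda>n. cross v (u n)) \<longlonglongrightarrow> cross v zeros"
    unfolding cross_def by (intro tendsto_intros) (auto simp: zeros_def u_lim)
  have "(\<lambda>n. glue v (u n) i) \<longlonglongrightarrow> glue v zeros i" for i
    using u_lim[of i] splits(2) outside[of i] by (auto simp: glue_def zeros_def)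
  then show "(\<lambda>n. glue v (u n)) \<longlonglongrightarrow> glue v zeros" by (simp add: tendsto_fun_iff)
  show "\<forall>\<^sub>F n in sequentially. glue v (u n) \<in> \<G> L N"
    using eventually_interlaced_eq[OF v(1)]
  proof eventually_elim
    case (elim n)
    show ?case
    proof (rule interlaces_in_\<G>[OF Xs_in[of n]])
      show "glue v (u n) \<in> extensional {1..N}"
        using outside by (auto simp: extensional_def glue_def B_def Z_def)
      fix i assume "i \<in> {1..N}"
      then consider "i \<in> B" | "i \<in> Z" "i \<notin> B" unfolding splits(1) by blast
      then show "glue v (u n) i \<in> I L (Xs n i) (Xs n (Suc i))"
      proof cases
        case 1
        then show ?thesis using elim v(2) by (simp add: glue_def)
      next
        case 2
        then show ?thesis using small_density_nonzeroD[OF u(2)] by (simp add: glue_def)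
      qed
    qed
  qed
qed

lemma small_density_support: "\<exists>u\<in>set_pmf U. small_density n u \<noteq> 0"
proof (rule ccontr)
  assume "\<not> (\<exists>u\<in>set_pmf U. small_density n u \<noteq> 0)"
  then have "measure_pmf.expectation U (small_density n) = 0"
    by (intro integral_eq_zero_AE AE_pmfI) auto
  then show False by (simp add: expectation_small_density)
qed

lemma glue_zeros_closure:
  assumes "v \<in> set_pmf V" "\<forall>i\<in>B. v i \<in> I L (X i) (X (Suc i))"
  shows "glue v zeros \<in> \<G>_closure L N"
proof -
  \<comment> \<open>Any choice of support points gives an approximating sequence; the supports are
    nonempty because the densities have mass 1.\<close>
  obtain u where u: "\<And>n. u n \<in> set_pmf U" "\<And>n. small_density n (u n) \<noteq> 0"
    using small_density_support by metis
  have "\<forall>\<^sub>F n in sequentially. glue v (u n) \<in> closure (\<G> L N)"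
    using glue_limit(1)[OF assms u] by eventually_elim (use closure_subset in auto)
  then show ?thesis
    unfolding \<G>_closure_eq
    by (rule Lim_in_closed_set[OF closed_closure _ sequentially_bot glue_limit(2)[OF assms u]])
qed

lemma abs_averaged_le:
  assumes f: "\<And>Y. \<bar>f Y\<bar> \<le> M" and "v \<in> set_pmf V"
  shows "\<bar>averaged f n v\<bar> \<le> (\<Prod>i\<in>B. \<Prod>j\<in>Z. 2 * R) * M"
  unfolding averaged_def
proof (rule abs_expectation_density_le[OF small_density_nonneg integrable_small_density expectation_small_density])
  fix u assume "u \<in> set_pmf U"
  from cross_le[OF assms(2) this] show "\<bar>cross v u * f (glue v u)\<bar> \<le> (\<Prod>i\<in>B. \<Prod>j\<in>Z. 2 * R) * M"
    unfolding abs_mult by (intro mult_mono f) auto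
qed

lemma averaged_tendsto:
  assumes f: "\<And>Y. \<bar>f Y\<bar> \<le> M" "continuous_on (\<G>_closure L N) f"
    and v: "v \<in> set_pmf V" "\<forall>i\<in>B. v i \<in> I L (X i) (X (Suc i))"
  shows "(\<lambda>n. averaged f n v) \<longlonglongrightarrow> cross v zeros * f (glue v zeros)"
  unfolding averaged_def
proof (rule expectation_concentrating[OF small_density_nonneg integrable_small_density expectation_small_density])
  fix u assume "u \<in> set_pmf U"
  from cross_le[OF v(1) this] show "\<bar>cross v u * f (glue v u)\<bar> \<le> (\<Prod>i\<in>B. \<Prod>j\<in>Z. 2 * R) * M"
    unfolding abs_mult by (intro mult_mono f) auto
next
  fix u assume u: "\<And>n. u n \<in> set_pmf U" "\<And>n. small_density n (u n) \<noteq> 0"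
  have "\<forall>\<^sub>F n in sequentially. glue v (u n) \<in> \<G>_closure L N"
    using glue_limit(1)[OF v u] by eventually_elim (use \<G>_subset_closure in auto)
  then have "(\<lambda>n. f (glue v (u n))) \<longlonglongrightarrow> f (glue v zeros)"
    by (intro continuous_on_tendsto_compose[OF f(2) glue_limit(2)[OF v u] glue_zeros_closure[OF v]])
  then show "(\<lambda>n. cross v (u n) * f (glue v (u n))) \<longlonglongrightarrow> cross v zeros * f (glue v zeros)"
    by (intro tendsto_mult glue_limit(3)[OF v u])
qed

text \<open>It involves \<open>X\<close> and the box but not \<open>Xs\<close>, so all sequences
  with the same limit lead to the same value.\<close>

definition limit_expectation :: "((nat \<Rightarrow> real) \<Rightarrow> real) \<Rightarrow> real" where
  "limit_expectation f = measure_pmf.expectation V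
     (\<lambda>v. big_density X v * cross v zeros * f (glue v zeros))"

lemma expectation_link_tendsto:
  assumes f: "\<And>Y. \<bar>f Y\<bar> \<le> M" "continuous_on (\<G>_closure L N) f"
  shows "(\<lambda>n. measure_pmf.expectation (link_pmf N (Xs n)) f) \<longlonglongrightarrow> limit_expectation f"
  unfolding expectation_link_eq_averaged[OF f(1)] limit_expectation_def
proof -
  obtain C where C: "0 \<le> C" "\<And>n v. v \<in> set_pmf V \<Longrightarrow> \<bar>big_density (Xs n) v\<bar> \<le> C"
    using big_density_bounded by auto
  let ?D = "(\<Prod>i\<in>B. \<Prod>j\<in>Z. 2 * R) * M"
  show "(\<lambda>n. measure_pmf.expectation V (\<lambda>v. big_density (Xs n) v * averaged f n v))
      \<longlonglongrightarrow> measure_pmf.expectation V (\<lambda>v. big_density X v * cross v zeros * f (glue v zeros))"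
  proof (rule integral_dominated_convergence[where w="\<lambda>_. C * ?D"])
    show "AE v in measure_pmf V. (\<lambda>n. big_density (Xs n) v * averaged f n v)
      \<longlonglongrightarrow> big_density X v * cross v zeros * f (glue v zeros)"
    proof (rule AE_pmfI)
      fix v assume v: "v \<in> set_pmf V"
      show "(\<lambda>n. big_density (Xs n) v * averaged f n v)
        \<longlonglongrightarrow> big_density X v * cross v zeros * f (glue v zeros)"
      proof (cases "\<forall>i\<in>B. v i \<in> I L (X i) (X (Suc i))")
        case True
        then show ?thesis
          unfolding mult.assoc
          by (intro tendsto_mult big_density_tendsto averaged_tendsto[OF f] v)
      next
        \<comment> \<open>Off the limiting interlacing region the density is eventually 0, so the
          product vanishes whatever \<open>averaged\<close> does.\<close>
        case False
        have "\<forall>\<^sub>F n in sequentially. big_density (Xs n) v * averaged f n v = 0"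
          using eventually_interlaced_eq[OF v]
        proof eventually_elim
          case (elim n)
          with False have "big_density (Xs n) v = 0" using big_density_nonzeroD by blast
          then show ?case by simp
        qed
        moreover have "big_density X v = 0" using False big_density_nonzeroD by blast
        ultimately show ?thesis by (auto intro: tendsto_eventually)
      qed
    qed
    show "AE v in measure_pmf V. norm (big_density (Xs n) v * averaged f n v) \<le> C * ?D" for n
    proof (rule AE_pmfI)
      fix v assume v: "v \<in> set_pmf V"
      show "norm (big_density (Xs n) v * averaged f n v) \<le> C * ?D"
        unfolding real_norm_def abs_mult
        by (intro mult_mono C v abs_averaged_le[OF f(1)]) auto
    qed
  qed auto
qed

lemma limit_pmf_exists:
  "\<exists>p. set_pmf p \<subseteq> \<G>_closure L N \<and>
     (\<forall>f :: _ \<Rightarrow> real. measure_pmf.expectation p f = limit_expectation f)"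
proof -
  let ?w = "\<lambda>v. big_density X v * cross v zeros"
  \<comment> \<open>Testing the convergence on the constant 1 shows that no mass is lost, without
    evaluating the limiting weights.\<close>
  have "(\<lambda>n. measure_pmf.expectation (link_pmf N (Xs n)) (\<lambda>_. 1)) \<longlonglongrightarrow> limit_expectation (\<lambda>_. 1)"
    by (rule expectation_link_tendsto[where M=1]) auto
  then have one: "measure_pmf.expectation V ?w = 1"
    by (simp add: limit_expectation_def LIMSEQ_const_iff)
  have nonneg: "0 \<le> ?w v" for v
    unfolding cross_def by (intro mult_nonneg_nonneg big_density_nonneg prod_nonneg) auto
  \<comment> \<open>A non-integrable function has integral 0 by convention, which contradicts the
    value 1.\<close>
  have "integrable (measure_pmf V) ?w"
    by (rule ccontr) (use one in \<open>simp add: not_integrable_integral_eq\<close>)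
  from reweighted_pmf_exists[OF nonneg this one]
  obtain p' where p': "\<And>v. pmf p' v = pmf V v * ?w v"
    "\<And>f :: _ \<Rightarrow> real. measure_pmf.expectation p' f = measure_pmf.expectation V (\<lambda>v. ?w v * f v)"
    by blast
  show ?thesis
  proof (intro exI[of _ "map_pmf (\<lambda>v. glue v zeros) p'"] conjI allI)
    show "set_pmf (map_pmf (\<lambda>v. glue v zeros) p') \<subseteq> \<G>_closure L N"
    proof
      fix Y assume "Y \<in> set_pmf (map_pmf (\<lambda>v. glue v zeros) p')"
      then obtain v where v: "Y = glue v zeros" "v \<in> set_pmf p'" by auto
      then have "v \<in> set_pmf V" "big_density X v \<noteq> 0" by (auto simp: set_pmf_iff p'(1))
      then show "Y \<in> \<G>_closure L N"
        unfolding v(1) by (intro glue_zeros_closure ballI big_density_nonzeroD)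
    qed
  qed (simp add: p'(2) limit_expectation_def)
qed

end

section \<open>Feller extensions of the links\<close>

text \<open>Each point \<open>xs n\<close> of the closure is replaced by a point of \<open>A\<close>
  close to it both in position and in the value of \<open>g\<close>; the hypothesis at
  \<open>xs n\<close> supplies such a point.\<close>

lemma continuous_on_closure_of_sequential_limits:
  fixes g :: "'a::metric_space \<Rightarrow> real"
  assumes "\<And>x xs. x \<in> closure A \<Longrightarrow> (\<And>n. xs n \<in> A) \<Longrightarrow> xs \<longlonglongrightarrow> x \<Longrightarrow> (\<lambda>n. g (xs n)) \<longlonglongrightarrow> g x"
  shows "continuous_on (closure A) g"
  unfolding continuous_on_sequentially
proof (intro allI ballI impI, elim conjE)
  fix xs :: "nat \<Rightarrow> 'a" and x
  assume x: "x \<in> closure A" and xs: "\<forall>n. xs n \<in> closure A" "xs \<longlonglongrightarrow> x"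
  have "\<exists>y\<in>A. dist y (xs n) < 1 / Suc n \<and> \<bar>g y - g (xs n)\<bar> < 1 / Suc n" for n
  proof -
    obtain ys where ys: "\<And>k. ys k \<in> A" "ys \<longlonglongrightarrow> xs n"
      using xs(1) by (auto simp: closure_sequential)
    have "\<forall>\<^sub>F k in sequentially. dist (ys k) (xs n) < 1 / Suc n"
      using ys(2) by (rule tendstoD) simp
    moreover have "\<forall>\<^sub>F k in sequentially. dist (g (ys k)) (g (xs n)) < 1 / Suc n"
      using assms[OF _ ys] xs(1) by (intro tendstoD) auto
    ultimately have "\<forall>\<^sub>F k in sequentially. dist (ys k) (xs n) < 1 / Suc n \<and> dist (g (ys k)) (g (xs n)) < 1 / Suc n"
      by eventually_elim simp
    from eventually_happens'[OF sequentially_bot this] show ?thesis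
      using ys(1) by (auto simp: dist_real_def)
  qed
  then obtain ys where ys: "\<And>n. ys n \<in> A" "\<And>n. dist (ys n) (xs n) < 1 / Suc n"
    "\<And>n. \<bar>g (ys n) - g (xs n)\<bar> < 1 / Suc n"
    by metis
  have inv: "(\<lambda>n. 1 / real (Suc n)) \<longlonglongrightarrow> 0"
    using LIMSEQ_inverse_real_of_nat by (simp add: inverse_eq_divide)
  have "(\<lambda>n. dist (ys n) x) \<longlonglongrightarrow> 0"
  proof (rule tendsto_sandwich[OF _ _ tendsto_const])
    show "(\<lambda>n. 1 / real (Suc n) + dist (xs n) x) \<longlonglongrightarrow> 0"
      using tendsto_add[OF inv xs(2)[unfolded tendsto_dist_iff[of xs]]] by simp
    show "\<forall>\<^sub>F n in sequentially. dist (ys n) x \<le> 1 / real (Suc n) + dist (xs n) x"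
    proof (intro always_eventually allI)
      fix n show "dist (ys n) x \<le> 1 / real (Suc n) + dist (xs n) x"
        using dist_triangle[of "ys n" x "xs n"] ys(2)[of n] by linarith
    qed
  qed simp
  then have "ys \<longlonglongrightarrow> x"
    by (simp add: tendsto_dist_iff[of ys])
  then have "(\<lambda>n. g (ys n)) \<longlonglongrightarrow> g x" by (intro assms x ys)
  moreover have "(\<lambda>n. g (ys n) - g (xs n)) \<longlonglongrightarrow> 0"
  proof (rule tendsto_rabs_zero_cancel, rule tendsto_sandwich[OF _ _ tendsto_const inv])
    show "\<forall>\<^sub>F n in sequentially. \<bar>g (ys n) - g (xs n)\<bar> \<le> 1 / real (Suc n)"
      by (intro always_eventually allI less_imp_le ys)
  qed simp
  ultimately have "(\<lambda>n. g (ys n) - (g (ys n) - g (xs n))) \<longlonglongrightarrow> g x - 0"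
    by (rule tendsto_diff)
  then show "(g \<circ> xs) \<longlonglongrightarrow> g x" by (simp add: comp_def)
qed

context q_lattice
begin

lemma one_step_limit:
  assumes X: "X \<in> \<G>_closure L (Suc N)"
  shows "\<exists>p. set_pmf p \<subseteq> \<G>_closure L N \<and> (\<forall>Xs (f :: _ \<Rightarrow> real) M. (\<forall>n. Xs n \<in> \<G> L (Suc N)) \<longrightarrow> Xs \<longlonglongrightarrow> X \<longrightarrow>
    (\<forall>Y. \<bar>f Y\<bar> \<le> M) \<longrightarrow> continuous_on (\<G>_closure L N) f \<longrightarrow>
    (\<lambda>n. measure_pmf.expectation (link_pmf N (Xs n)) f) \<longlonglongrightarrow> measure_pmf.expectation p f)"
proof -
  obtain b a where box: "q_lattice_box q zp zm L b a"
    and le: "\<And>r. \<bar>r\<bar> \<le> Max ((\<lambda>i. \<bar>X i\<bar>) ` {1..Suc N}) \<Longrightarrow> b < r \<and> r < a"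
    using L_unbounded by blast
  have X_box: "b < X i \<and> X i < a" if "i \<in> {1..Suc N}" for i
    by (intro le Max_ge) (use that in auto)
  have shift: "\<exists>k. degenerating q zp zm L b a N X (\<lambda>n. Xs (n + k))"
    if Xs: "\<And>n. Xs n \<in> \<G> L (Suc N)" "Xs \<longlonglongrightarrow> X" for Xs
  proof -
    have "\<forall>\<^sub>F n in sequentially. \<forall>i\<in>{1..Suc N}. Xs n i \<in> {b..a} \<and> (X i \<noteq> 0 \<longrightarrow> Xs n i = X i)"
    proof (rule eventually_ball_finite)
      show "\<forall>i\<in>{1..Suc N}. \<forall>\<^sub>F n in sequentially. Xs n i \<in> {b..a} \<and> (X i \<noteq> 0 \<longrightarrow> Xs n i = X i)"
      proof
        fix i assume i: "i \<in> {1..Suc N}"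
        have lim: "(\<lambda>n. Xs n i) \<longlonglongrightarrow> X i" using Xs(2) by (simp add: tendsto_fun_iff)
        have "\<forall>\<^sub>F n in sequentially. b < Xs n i" "\<forall>\<^sub>F n in sequentially. Xs n i < a"
          using X_box[OF i] by (auto intro: order_tendstoD[OF lim])
        moreover have "\<forall>\<^sub>F n in sequentially. X i \<noteq> 0 \<longrightarrow> Xs n i = X i"
          using \<G>_limit(2)[OF Xs i] by (cases "X i = 0") auto
        ultimately show "\<forall>\<^sub>F n in sequentially. Xs n i \<in> {b..a} \<and> (X i \<noteq> 0 \<longrightarrow> Xs n i = X i)"
          by eventually_elim auto
      qed
    qed simp
    then obtain k where k: "\<forall>n\<ge>k. \<forall>i\<in>{1..Suc N}. Xs n i \<in> {b..a} \<and> (X i \<noteq> 0 \<longrightarrow> Xs n i = X i)"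
      unfolding eventually_sequentially by blast
    have "degenerating q zp zm L b a N X (\<lambda>n. Xs (n + k))"
      unfolding degenerating_def degenerating_axioms_def
    proof (intro conjI allI impI box)
      show "(\<lambda>n. Xs (n + k)) \<longlonglongrightarrow> X" by (rule LIMSEQ_ignore_initial_segment[OF Xs(2)])
    qed (use Xs(1) k in simp_all)
    then show ?thesis ..
  qed
  \<comment> \<open>The \<open>pmf\<close> is built from one particular sequence but must serve all
    of them; the box is fixed by \<open>X\<close>, and \<open>limit_expectation\<close> does not
    mention the sequence.\<close>
  obtain Xs0 where Xs0: "\<And>n. Xs0 n \<in> \<G> L (Suc N)" "Xs0 \<longlonglongrightarrow> X"
    using X by (auto simp: \<G>_closure_iff)
  obtain k0 where k0: "degenerating q zp zm L b a N X (\<lambda>n. Xs0 (n + k0))"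
    using shift[OF Xs0] ..
  obtain p where p: "set_pmf p \<subseteq> \<G>_closure L N"
    "\<And>f :: _ \<Rightarrow> real. measure_pmf.expectation p f = degenerating.limit_expectation q L b a N X f"
    using degenerating.limit_pmf_exists[OF k0] by blast
  show ?thesis
  proof (intro exI[of _ p] conjI allI impI p(1))
    fix Xs and f :: "(nat \<Rightarrow> real) \<Rightarrow> real" and M
    assume Xs: "\<forall>n. Xs n \<in> \<G> L (Suc N)" "Xs \<longlonglongrightarrow> X"
      and f: "\<forall>Y. \<bar>f Y\<bar> \<le> M" "continuous_on (\<G>_closure L N) f"
    obtain k where k: "degenerating q zp zm L b a N X (\<lambda>n. Xs (n + k))"
      using shift[of Xs] Xs by blast
    have "(\<lambda>n. measure_pmf.expectation (link_pmf N (Xs (n + k))) f) \<longlonglongrightarrow> measure_pmf.expectation p f"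
      unfolding p(2) by (rule degenerating.expectation_link_tendsto[OF k]) (use f in auto)
    then show "(\<lambda>n. measure_pmf.expectation (link_pmf N (Xs n)) f) \<longlonglongrightarrow> measure_pmf.expectation p f"
      by (rule LIMSEQ_offset)
  qed
qed

end

section \<open>Probability measures on countable subspaces\<close>

lemma sets_restrict_borel_countable:
  fixes S :: "'a::t1_space set"
  assumes "countable S"
  shows "sets (restrict_space borel S) = Pow S"
proof
  show "Pow S \<subseteq> sets (restrict_space borel S)"
  proof
    fix A assume "A \<in> Pow S"
    then have "A = A \<inter> S" "countable A"
      using countable_subset[OF _ assms] by auto
    moreover from this(2) have "A \<in> sets borel"
      by (rule sets.countable[rotated]) simp
    ultimately show "A \<in> sets (restrict_space borel S)"
      unfolding sets_restrict_space by blast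
  qed
qed (auto simp: sets_restrict_space)

lemma sets_prob_measures_countable:
  fixes S :: "'a::t1_space set"
  shows "countable S \<Longrightarrow> \<mu> \<in> prob_measures S \<Longrightarrow> sets \<mu> = Pow S"
  by (simp add: prob_measures_def sets_restrict_borel_countable)

lemma restrict_pmf_prob_measure:
  fixes S :: "'a::t1_space set"
  assumes "countable S" "set_pmf p \<subseteq> S"
  shows "restrict_space (measure_pmf p) S \<in> prob_measures S"
proof -
  have "emeasure (measure_pmf p) S = 1"
    using assms(2) by (subst measure_pmf.emeasure_eq_1_AE) (auto simp: AE_measure_pmf_iff)
  then have "prob_space (restrict_space (measure_pmf p) S)"
    by (intro prob_spaceI) (simp add: emeasure_restrict_space space_restrict_space)
  moreover have "sets (restrict_space (measure_pmf p) S) = Pow S"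
    by (auto simp: sets_restrict_space)
  ultimately show ?thesis
    by (simp add: prob_measures_def sets_restrict_borel_countable[OF assms(1)])
qed

lemma integral_restrict_pmf:
  fixes f :: "'a \<Rightarrow> real"
  shows "(\<integral>x. f x \<partial>restrict_space (measure_pmf p) S)
    = measure_pmf.expectation p (\<lambda>x. if x \<in> S then f x else 0)"
  by (subst integral_restrict_space) (auto intro!: Bochner_Integration.integral_cong simp: indicator_def)

text \<open>The right-hand side has the shape of \<open>links_measure\<close>, with \<open>G\<close>
  the lattice configurations and \<open>S\<close> their closure.\<close>

lemma restrict_pmf_eq_distr_point_measure:
  fixes S :: "'a::t1_space set"
  assumes "countable S" "G \<subseteq> S" "set_pmf p \<subseteq> G" "\<And>x. x \<in> G \<Longrightarrow> pmf p x = w x"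
  shows "restrict_space (measure_pmf p) S
    = distr (point_measure G (\<lambda>x. ennreal (w x))) (restrict_space borel S) (\<lambda>x. x)"
proof (rule measure_eqI)
  fix A assume "A \<in> sets (restrict_space (measure_pmf p) S)"
  then have A: "A \<subseteq> S" by (auto simp: sets_restrict_space)
  have meas: "(\<lambda>x. x) \<in> measurable (point_measure G (\<lambda>x. ennreal (w x))) (restrict_space borel S)"
    using assms(2) by (auto simp: measurable_def sets_restrict_borel_countable[OF assms(1)]
        space_restrict_space space_point_measure sets_point_measure)
  have "emeasure (distr (point_measure G (\<lambda>x. ennreal (w x))) (restrict_space borel S) (\<lambda>x. x)) A
      = emeasure (point_measure G (\<lambda>x. ennreal (w x))) (A \<inter> G)"
    using A by (subst emeasure_distr[OF meas])
      (auto simp: sets_restrict_borel_countable[OF assms(1)] space_point_measure)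
  also have "\<dots> = (\<integral>\<^sup>+x. ennreal (w x) * indicator (A \<inter> G) x \<partial>count_space G)"
    unfolding point_measure_def by (subst emeasure_density) auto
  also have "\<dots> = (\<integral>\<^sup>+x. ennreal (pmf p x) * indicator (A \<inter> G) x \<partial>count_space G)"
    by (intro nn_integral_cong) (auto simp: assms(4))
  also have "\<dots> = (\<integral>\<^sup>+x. ennreal (pmf p x) \<partial>count_space (A \<inter> G))"
    by (subst (1 2) nn_integral_count_space_indicator)
       (auto intro!: nn_integral_cong simp: indicator_def)
  also have "\<dots> = emeasure (measure_pmf p) (A \<inter> G)"
    by (rule nn_integral_pmf)
  also have "\<dots> = emeasure (measure_pmf p) A"
    using assms(3) by (intro emeasure_eq_AE) (auto simp: AE_measure_pmf_iff)
  finally show "emeasure (restrict_space (measure_pmf p) S) A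
      = emeasure (distr (point_measure G (\<lambda>x. ennreal (w x))) (restrict_space borel S) (\<lambda>x. x)) A"
    using A by (simp add: emeasure_restrict_space)
qed (simp add: sets_restrict_borel_countable[OF assms(1)], auto simp: sets_restrict_space)

lemma prob_measures_eqI_countable:
  fixes S :: "'a::metric_space set"
  assumes S: "countable S" and \<mu>: "\<mu> \<in> prob_measures S" and \<nu>: "\<nu> \<in> prob_measures S"
    and eq: "\<And>f :: 'a \<Rightarrow> real. continuous_on S f \<Longrightarrow> bounded (f ` S) \<Longrightarrow> (\<integral>x. f x \<partial>\<mu>) = (\<integral>x. f x \<partial>\<nu>)"
  shows "\<mu> = \<nu>"
proof (rule measure_eqI_countable)
  fix y assume y: "y \<in> S"
  \<comment> \<open>Tent functions centred at \<open>y\<close> decrease to the indicator of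
    \<open>{y}\<close>, so their integrals recover the point mass.\<close>
  define f where "f n x = max 0 (1 - real n * dist x y)" for n x
  have f_cont: "continuous_on S (f n)" for n
    unfolding f_def by (intro continuous_intros)
  have f_bound: "\<bar>f n x\<bar> \<le> 1" for n x by (simp add: f_def)
  have f_lim: "(\<lambda>n. f n x) \<longlonglongrightarrow> indicator {y} x" for x
  proof (cases "x = y")
    case False
    then obtain k where k: "1 / dist x y < real k" using reals_Archimedean2 by blast
    have "f n x = 0" if "k \<le> n" for n
    proof -
      have "1 < real k * dist x y" using k False by (simp add: divide_less_eq)
      also have "\<dots> \<le> real n * dist x y" using that by (simp add: mult_right_mono)
      finally show ?thesis by (simp add: f_def)
    qed
    then have "\<forall>\<^sub>F n in sequentially. f n x = 0" by (auto simp: eventually_sequentially)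
    then show ?thesis using False by (simp add: tendsto_eventually)
  qed (simp add: f_def)
  have lim: "(\<lambda>n. \<integral>x. f n x \<partial>\<rho>) \<longlonglongrightarrow> measure \<rho> {y}" if \<rho>: "\<rho> \<in> prob_measures S" for \<rho>
  proof -
    interpret prob_space \<rho> using \<rho> by (simp add: prob_measures_def)
    have sets: "sets \<rho> = Pow S" by (rule sets_prob_measures_countable[OF S \<rho>])
    have meas: "g \<in> borel_measurable \<rho>" for g :: "'a \<Rightarrow> real"
      using sets sets_eq_imp_space_eq[of \<rho> "count_space S"] by (auto simp: measurable_def)
    have "(\<lambda>n. \<integral>x. f n x \<partial>\<rho>) \<longlonglongrightarrow> (\<integral>x. indicator {y} x \<partial>\<rho>)"
      by (rule integral_dominated_convergence[where w="\<lambda>_. 1"]) (auto simp: meas f_lim f_bound)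
    also have "(\<integral>x. indicator {y} x \<partial>\<rho>) = measure \<rho> {y}"
      using sets y by simp
    finally show ?thesis .
  qed
  have "(\<integral>x. f n x \<partial>\<mu>) = (\<integral>x. f n x \<partial>\<nu>)" for n
    using f_bound by (intro eq f_cont) (auto simp: bounded_iff)
  then have "measure \<mu> {y} = measure \<nu> {y}"
    using lim[OF \<mu>] lim[OF \<nu>] LIMSEQ_unique by simp
  then show "emeasure \<mu> {y} = emeasure \<nu> {y}"
    using \<mu> \<nu> by (simp add: prob_measures_def finite_measure.emeasure_eq_measure prob_space.finite_measure)
qed (use S \<mu> \<nu> sets_prob_measures_countable in auto)

section \<open>The weak topology and its continuous maps\<close>

lemma topspace_weak_topology:
  "topspace (weak_topology S) = prob_measures (S :: 'a::topological_space set)"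
proof -
  let ?B = "{{\<mu> \<in> prob_measures S. (\<integral>x. f x \<partial>\<mu>) \<in> U} |
      (f :: 'a \<Rightarrow> real) U. continuous_on S f \<and> bounded (f ` S) \<and> open U}"
  \<comment> \<open>The zero function with target \<open>UNIV\<close> puts the whole space among the
    generating sets.\<close>
  have "{\<mu> \<in> prob_measures S. (\<integral>x. (\<lambda>_. 0 :: real) x \<partial>\<mu>) \<in> UNIV} \<in> ?B"
    by (rule CollectI, intro exI[of _ "\<lambda>_. 0"] exI[of _ UNIV]) (auto simp: image_constant_conv)
  then have "prob_measures S \<in> ?B" by simp
  then have "\<Union>?B = prob_measures S" by blast
  then show ?thesis by (simp add: weak_topology_def topology_generated_by_topspace)
qed

lemma continuous_map_integral_weak_topology:
  fixes f :: "'a::topological_space \<Rightarrow> real"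
  assumes "continuous_on S f" "bounded (f ` S)"
  shows "continuous_map (weak_topology S) euclidean (\<lambda>\<mu>. \<integral>x. f x \<partial>\<mu>)"
  unfolding continuous_map_def topspace_weak_topology
proof (intro conjI allI impI)
  fix U :: "real set" assume "openin euclidean U"
  then show "openin (weak_topology S) {\<mu> \<in> prob_measures S. (\<integral>x. f x \<partial>\<mu>) \<in> U}"
    using assms unfolding weak_topology_def by (intro topology_generated_by_Basis) auto
qed simp

lemma continuous_map_weak_topologyI:
  assumes "F \<in> topspace T \<rightarrow> prob_measures S"
    and "\<And>f :: 'a::topological_space \<Rightarrow> real. continuous_on S f \<Longrightarrow> bounded (f ` S) \<Longrightarrow>
      continuous_map T euclidean (\<lambda>X. \<integral>x. f x \<partial>F X)"
  shows "continuous_map T (weak_topology S) F"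
  unfolding weak_topology_def
proof (rule continuous_on_generated_topo)
  fix W assume "W \<in> {{\<mu> \<in> prob_measures S. (\<integral>x. f x \<partial>\<mu>) \<in> U} |
        (f :: 'a \<Rightarrow> real) U. continuous_on S f \<and> bounded (f ` S) \<and> open U}"
  then obtain f :: "'a \<Rightarrow> real" and U where f: "continuous_on S f" "bounded (f ` S)" "open U"
    and W: "W = {\<mu> \<in> prob_measures S. (\<integral>x. f x \<partial>\<mu>) \<in> U}" by blast
  have "openin T {X \<in> topspace T. (\<integral>x. f x \<partial>F X) \<in> U}"
    using openin_continuous_map_preimage[OF assms(2)[OF f(1,2)]] f(3) by auto
  also have "{X \<in> topspace T. (\<integral>x. f x \<partial>F X) \<in> U} = F -` W \<inter> topspace T"
    using assms(1) by (auto simp: W)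
  finally show "openin T (F -` W \<inter> topspace T)" .
next
  show "F ` topspace T \<subseteq> \<Union> {{\<mu> \<in> prob_measures S. (\<integral>x. f x \<partial>\<mu>) \<in> U} |
        (f :: 'a \<Rightarrow> real) U. continuous_on S f \<and> bounded (f ` S) \<and> open U}"
    using assms(1) topspace_weak_topology[of S]
    unfolding weak_topology_def topology_generated_by_topspace by auto
qed

section \<open>Feller kernels on the closures and their composition\<close>

context q_lattice
begin

definition feller :: "nat \<Rightarrow> nat \<Rightarrow> ((nat \<Rightarrow> real) \<Rightarrow> (nat \<Rightarrow> real) pmf) \<Rightarrow> bool" where
  "feller N K P \<longleftrightarrow> (\<forall>X\<in>\<G>_closure L N. set_pmf (P X) \<subseteq> \<G>_closure L K) \<and>
     (\<forall>(f :: _ \<Rightarrow> real) M. (\<forall>Y. \<bar>f Y\<bar> \<le> M) \<longrightarrow> continuous_on (\<G>_closure L K) f \<longrightarrow>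
        continuous_on (\<G>_closure L N) (\<lambda>X. measure_pmf.expectation (P X) f))"

lemma fellerD:
  assumes "feller N K P"
  shows "X \<in> \<G>_closure L N \<Longrightarrow> set_pmf (P X) \<subseteq> \<G>_closure L K"
    "(\<And>Y. \<bar>f Y\<bar> \<le> M) \<Longrightarrow> continuous_on (\<G>_closure L K) f \<Longrightarrow>
      continuous_on (\<G>_closure L N) (\<lambda>X. measure_pmf.expectation (P X) (f :: _ \<Rightarrow> real))"
  using assms unfolding feller_def by blast+

lemma feller_extension_link:
  "\<exists>P. feller (Suc N) N P \<and> (\<forall>X\<in>\<G> L (Suc N). P X = link_pmf N X)"
proof -
  let ?S = "\<G>_closure L"
  obtain p where p: "\<And>X. X \<in> ?S (Suc N) \<Longrightarrow> set_pmf (p X) \<subseteq> ?S N"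
    "\<And>X Xs (f :: _ \<Rightarrow> real) M. X \<in> ?S (Suc N) \<Longrightarrow> (\<And>n. Xs n \<in> \<G> L (Suc N)) \<Longrightarrow> Xs \<longlonglongrightarrow> X \<Longrightarrow>
      (\<And>Y. \<bar>f Y\<bar> \<le> M) \<Longrightarrow> continuous_on (?S N) f \<Longrightarrow>
      (\<lambda>n. measure_pmf.expectation (link_pmf N (Xs n)) f) \<longlonglongrightarrow> measure_pmf.expectation (p X) f"
    using one_step_limit[of _ N] by metis
  \<comment> \<open>On \<open>\<G> L (Suc N)\<close> the link row itself is kept, so that its matrix
    entries are directly available; the limit kernel serves the added points.\<close>
  define P where "P X = (if X \<in> \<G> L (Suc N) then link_pmf N X else p X)" for X
  have "feller (Suc N) N P"
    unfolding feller_def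
  proof (intro conjI ballI allI impI)
    fix X assume "X \<in> ?S (Suc N)"
    then show "set_pmf (P X) \<subseteq> ?S N"
      using p(1) set_link_pmf[of X N] \<G>_subset_closure[of L N] by (auto simp: P_def)
  next
    fix f :: "(nat \<Rightarrow> real) \<Rightarrow> real" and M
    assume f: "\<forall>Y. \<bar>f Y\<bar> \<le> M" "continuous_on (?S N) f"
    have lim: "(\<lambda>n. measure_pmf.expectation (link_pmf N (Xs n)) f) \<longlonglongrightarrow> measure_pmf.expectation (p X) f"
      if "X \<in> ?S (Suc N)" "\<And>n. Xs n \<in> \<G> L (Suc N)" "Xs \<longlonglongrightarrow> X" for X Xs
      using that f by (intro p(2)[of X Xs f M]) auto
    have eq: "measure_pmf.expectation (P X) f = measure_pmf.expectation (p X) f" if X: "X \<in> ?S (Suc N)" for X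
    proof (cases "X \<in> \<G> L (Suc N)")
      case True
      \<comment> \<open>The constant sequence shows that both kernels have the same expectations at
        a lattice configuration.\<close>
      from lim[OF X, of "\<lambda>_. X"] True show ?thesis by (simp add: P_def LIMSEQ_const_iff)
    qed (simp add: P_def)
    have "continuous_on (closure (\<G> L (Suc N))) (\<lambda>X. measure_pmf.expectation (P X) f)"
    proof (rule continuous_on_closure_of_sequential_limits)
      fix X Xs assume "X \<in> closure (\<G> L (Suc N))" and Xs: "\<And>n. Xs n \<in> \<G> L (Suc N)" "Xs \<longlonglongrightarrow> X"
      then have "X \<in> ?S (Suc N)" by (simp add: \<G>_closure_eq)
      with lim[OF this Xs] show "(\<lambda>n. measure_pmf.expectation (P (Xs n)) f) \<longlonglongrightarrow> measure_pmf.expectation (P X) f"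
        by (simp add: eq) (simp add: P_def Xs)
    qed
    then show "continuous_on (?S (Suc N)) (\<lambda>X. measure_pmf.expectation (P X) f)"
      by (simp add: \<G>_closure_eq)
  qed
  then show ?thesis by (intro exI[of _ P]) (simp add: P_def)
qed

lemma abs_expectation_le:
  assumes "\<And>Y. \<bar>f Y\<bar> \<le> M"
  shows "\<bar>measure_pmf.expectation p f\<bar> \<le> (M :: real)"
  using abs_expectation_density_le[of "\<lambda>_. 1" p f M] assms by simp

text \<open>Averaging over \<open>Q\<close> sends bounded continuous functions to bounded continuous
  functions, and the result is an admissible test function for \<open>P\<close>.\<close>

lemma feller_bind:
  assumes P: "feller N J P" and Q: "feller J K Q"
  shows "feller N K (\<lambda>X. bind_pmf (P X) Q)"
  unfolding feller_def
proof (intro conjI ballI allI impI)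
  fix X assume "X \<in> \<G>_closure L N"
  then show "set_pmf (bind_pmf (P X) Q) \<subseteq> \<G>_closure L K"
    using fellerD(1)[OF P] fellerD(1)[OF Q] by fastforce
next
  fix f :: "(nat \<Rightarrow> real) \<Rightarrow> real" and M
  assume f: "\<forall>Y. \<bar>f Y\<bar> \<le> M" "continuous_on (\<G>_closure L K) f"
  have "measure_pmf.expectation (bind_pmf (P X) Q) f
      = measure_pmf.expectation (P X) (\<lambda>Z. measure_pmf.expectation (Q Z) f)" for X
    using f(1) by (intro expectation_bind_pmf) auto
  then show "continuous_on (\<G>_closure L N) (\<lambda>X. measure_pmf.expectation (bind_pmf (P X) Q) f)"
    using f abs_expectation_le[of f M]
    by (auto intro!: fellerD(2)[OF P, of _ M] fellerD(2)[OF Q, of _ M])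
qed

lemma feller_extension_links:
  assumes "K < N"
  shows "\<exists>P. feller N K P \<and> (\<forall>X\<in>\<G> L N. set_pmf (P X) \<subseteq> \<G> L K \<and>
    (\<forall>Y\<in>\<G> L K. pmf (P X) Y = links q L K N X Y))"
proof -
  from assms have "Suc K \<le> N" by simp
  then show ?thesis
  proof (induction N rule: dec_induct)
    case base
    obtain P where P: "feller (Suc K) K P" "\<forall>X\<in>\<G> L (Suc K). P X = link_pmf K X"
      using feller_extension_link by blast
    then show ?case
      by (intro exI[of _ P]) (simp add: set_link_pmf pmf_link_pmf)
  next
    case (step N)
    obtain P where P: "feller (Suc N) N P" "\<forall>X\<in>\<G> L (Suc N). P X = link_pmf N X"
      using feller_extension_link by blast
    obtain Q where Q: "feller N K Q" "\<And>X. X \<in> \<G> L N \<Longrightarrow> set_pmf (Q X) \<subseteq> \<G> L K"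
      "\<And>X Y. X \<in> \<G> L N \<Longrightarrow> Y \<in> \<G> L K \<Longrightarrow> pmf (Q X) Y = links q L K N X Y"
      using step.IH by blast
    show ?case
    proof (intro exI[of _ "\<lambda>X. bind_pmf (P X) Q"] conjI ballI feller_bind[OF P(1) Q(1)])
      fix X assume X: "X \<in> \<G> L (Suc N)"
      show "set_pmf (bind_pmf (P X) Q) \<subseteq> \<G> L K"
        using P(2) X set_link_pmf[OF X] Q(2) by fastforce
      fix Y assume Y: "Y \<in> \<G> L K"
      have "pmf (bind_pmf (P X) Q) Y = measure_pmf.expectation (link_pmf N X) (\<lambda>Z. pmf (Q Z) Y)"
        using P(2) X by (simp add: pmf_bind)
      \<comment> \<open>The mass of the mixture is turned into the sum over intermediate
        configurations in the recursion of \<open>links\<close>.\<close>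
      also have "\<dots> = (\<Sum>\<^sub>\<infinity>Z\<in>\<G> L N. pmf (link_pmf N X) Z * pmf (Q Z) Y)"
        by (intro expectation_eq_infsum set_link_pmf X integrable_bounded_pmf[where C=1])
           (simp add: pmf_le_1)
      also have "\<dots> = (\<Sum>\<^sub>\<infinity>Z\<in>\<G> L N. link q L N X Z * links q L K N Z Y)"
        by (intro infsum_cong) (simp add: pmf_link_pmf[OF X] Q(3) Y)
      also have "\<dots> = links q L K (Suc N) X Y"
        using step.hyps by simp
      finally show "pmf (bind_pmf (P X) Q) Y = links q L K (Suc N) X Y" .
    qed
  qed
qed

end

section \<open>Existence and uniqueness of the continuous extension\<close>

theorem proposition4p2:
  fixes q zp zm :: real and L :: "real set" and N K :: nat
  assumes "0 < q" "q < 1" and "zp > 0" and "zm < 0"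
    and "L = two_sided_lattice q zp zm"
    and "1 \<le> K" and "K < N"
  shows "\<exists>!F. F \<in> \<G>_closure L N \<rightarrow>\<^sub>E prob_measures (\<G>_closure L K)
            \<and> (\<forall>X\<in>\<G> L N. F X = links_measure q L K N X)
            \<and> continuous_map (top_of_set (\<G>_closure L N)) (weak_topology (\<G>_closure L K)) F"
proof -
  interpret q_lattice q zp zm L by unfold_locales (use assms in auto)
  let ?SN = "\<G>_closure L N" and ?SK = "\<G>_closure L K"
  obtain P where P: "feller N K P" "\<And>X. X \<in> \<G> L N \<Longrightarrow> set_pmf (P X) \<subseteq> \<G> L K"
    "\<And>X Y. X \<in> \<G> L N \<Longrightarrow> Y \<in> \<G> L K \<Longrightarrow> pmf (P X) Y = links q L K N X Y"
    using feller_extension_links[OF assms(7)] by blast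
  define F where "F = (\<lambda>X\<in>?SN. restrict_space (measure_pmf (P X)) ?SK)"
  have F_in: "F \<in> ?SN \<rightarrow>\<^sub>E prob_measures ?SK"
    using restrict_pmf_prob_measure[OF countable_\<G>_closure fellerD(1)[OF P(1)]] by (simp add: F_def)
  have F_links: "F X = links_measure q L K N X" if X: "X \<in> \<G> L N" for X
  proof -
    have "X \<in> ?SN" using X \<G>_subset_closure by blast
    then show ?thesis
      unfolding F_def links_measure_def
      using restrict_pmf_eq_distr_point_measure[OF countable_\<G>_closure \<G>_subset_closure P(2)[OF X] P(3)[OF X]]
      by simp
  qed
  have F_cont: "continuous_map (top_of_set ?SN) (weak_topology ?SK) F"
  proof (rule continuous_map_weak_topologyI)
    show "F \<in> topspace (top_of_set ?SN) \<rightarrow> prob_measures ?SK" using F_in by auto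
    fix f :: "(nat \<Rightarrow> real) \<Rightarrow> real" assume f: "continuous_on ?SK f" "bounded (f ` ?SK)"
    \<comment> \<open>Extension by 0 makes the test function bounded everywhere and affects neither
      its continuity on the closure nor its integrals over it.\<close>
    let ?f = "\<lambda>Y. if Y \<in> ?SK then f Y else 0"
    obtain M where M: "0 < M" "\<And>Y. Y \<in> ?SK \<Longrightarrow> \<bar>f Y\<bar> \<le> M"
      using f(2) by (auto simp: bounded_pos)
    have "continuous_on ?SK ?f" using f(1) by (rule continuous_on_eq) simp
    then have "continuous_on ?SN (\<lambda>X. measure_pmf.expectation (P X) ?f)"
      using M by (intro fellerD(2)[OF P(1), of _ M]) auto
    then have "continuous_on ?SN (\<lambda>X. \<integral>Y. f Y \<partial>F X)"
      by (rule continuous_on_eq) (simp add: F_def integral_restrict_pmf)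
    then show "continuous_map (top_of_set ?SN) euclidean (\<lambda>X. \<integral>Y. f Y \<partial>F X)" by simp
  qed
  show ?thesis
  proof (rule ex1I[of _ F])
    show "F \<in> ?SN \<rightarrow>\<^sub>E prob_measures ?SK \<and> (\<forall>X\<in>\<G> L N. F X = links_measure q L K N X)
        \<and> continuous_map (top_of_set ?SN) (weak_topology ?SK) F"
      using F_in F_links F_cont by blast
  next
    fix F' assume F': "F' \<in> ?SN \<rightarrow>\<^sub>E prob_measures ?SK \<and> (\<forall>X\<in>\<G> L N. F' X = links_measure q L K N X)
        \<and> continuous_map (top_of_set ?SN) (weak_topology ?SK) F'"
    show "F' = F"
    proof (rule PiE_ext[of F' ?SN "\<lambda>_. prob_measures ?SK" F])
      fix X assume X: "X \<in> ?SN"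
      then obtain Xs where Xs: "\<And>n. Xs n \<in> \<G> L N" "Xs \<longlonglongrightarrow> X" by (auto simp: \<G>_closure_iff)
      show "F' X = F X"
      proof (rule prob_measures_eqI_countable[OF countable_\<G>_closure])
        fix f :: "(nat \<Rightarrow> real) \<Rightarrow> real" assume f: "continuous_on ?SK f" "bounded (f ` ?SK)"
        \<comment> \<open>Integration of \<open>f\<close> is weakly continuous, so every continuous
          candidate is determined at \<open>X\<close> by its values along \<open>Xs\<close>.\<close>
        have lim: "(\<lambda>n. \<integral>Y. f Y \<partial>H (Xs n)) \<longlonglongrightarrow> (\<integral>Y. f Y \<partial>H X)"
          if "continuous_map (top_of_set ?SN) (weak_topology ?SK) H" for H
        proof -
          have "continuous_on ?SN (\<lambda>X. \<integral>Y. f Y \<partial>H X)"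
            using continuous_map_compose[OF that continuous_map_integral_weak_topology[OF f]]
            by (simp add: comp_def)
          then show ?thesis
            using Xs \<G>_subset_closure[of L N]
            by (intro continuous_on_tendsto_compose[OF _ Xs(2) X]) (auto intro!: always_eventually)
        qed
        have "F' (Xs n) = F (Xs n)" for n using F' F_links Xs(1) by simp
        then show "(\<integral>Y. f Y \<partial>F' X) = (\<integral>Y. f Y \<partial>F X)"
          using lim[OF F_cont] lim[of F'] F' LIMSEQ_unique by simp
      qed (use X F' F_in in auto)
    qed (use F' F_in in auto)
  qed
qed

end
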